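(* Let $p\ge3$, $G=SL(3)$, and let $\lambda=(\lambda_1,\lambda_2)$ be a dominant weight. Then: (1) $\mathcal{V}_{B_1}(H^0(e,\lambda))=\mathfrak{u}$ for all $\lambda$; (2) $\mathcal{V}_{B_1}(H^0(s_\alpha,\lambda))=\mathfrak{u}_\alpha$ if $p\mid\lambda_1+1$, and $=\mathfrak{u}$ if $p\nmid\lambda_1+1$; (3) $\mathcal{V}_{B_1}(H^0(s_\beta,\lambda))=\mathfrak{u}_\beta$ if $p\mid\lambda_2+1$, and $=\mathfrak{u}$ if $p\nmid\lambda_2+1$; (4) $\mathcal{V}_{B_1}(H^0(s_\alpha s_\beta s_\alpha,\lambda))=\mathcal{V}_{G_1}(H^0(\lambda))\cap\mathfrak{u}$ for all $\lambda$.
   Context: Setting: $k$ is an algebraically closed field of characteristic $p$, $G=SL(3)$ over $k$ with maximal torus $T$, simple roots $\Delta=\{\alpha,\beta\}$, Weyl group $W$, and $B\supset T$ the Borel subgroup corresponding to the negative roots. A weight is written $\lambda=(\lambda_1,\lambda_2)$ with $\lambda_1=(\lambda,\alpha^\vee)$, $\lambda_2=(\lambda,\beta^\vee)$. $\mathfrak{u}$ is the Lie algebra of the unipotent radical of $B$. $P_\alpha\supset B$ is the minimal parabolic subgroup whose Levi factor containing $T$ has roots $\pm\alpha$, and $\mathfrak{u}_\alpha$ is the Lie algebra of its unipotent radical; similarly $P_\beta$, $\mathfrak{u}_\beta$. For $w\in W$, $X(w)$ is the closure of $B\dot wB/B$ in $G/B$; $\mathcal{L}(\lambda)$ is the line bundle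 on $G/B$ with $H^0(\lambda):=H^0(G/B,\mathcal{L}(\lambda))=\operatorname{ind}_B^G\lambda$; $H^0(w,\lambda)=H^0(X(w),\mathcal{L}(\lambda))$. Support varieties over the first Frobenius kernel $H_1$ of $H\in\{B,G\}$, $\mathfrak{h}=\mathrm{Lie}(H)$: for a finite-dimensional $H_1$-module $M$, $\mathcal{V}_{H_1}(M)$ is the closed subvariety of $\mathrm{Maxspec}\,H^{2\bullet}(H_1,k)$ defined by the annihilator of $\mathrm{Ext}^\bullet_{H_1}(M,M)$. It is identified with $\{x\in\mathcal{N}_1(\mathfrak{h}) : M\text{ is not projective over the restricted enveloping algebra } k[x]/(x^p)\text{ of }\langle x\rangle\}\cup\{0\}$, where $\mathcal{N}_1(\mathfrak{h})=\{x\in\mathfrak{h}:x^{[p]}=0\}$; here $\mathcal{N}_1(\mathrm{Lie}\,B)=\mathfrak{u}$. *)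

theory Defs
  imports "HOL-Analysis.Analysis" "HOL-Computational_Algebra.Polynomial"
begin

section \<open>Regular functions, Zariski topology and tangent spaces inside 3 x 3 matrices\<close>

text \<open>All varieties below are Zariski-closed subsets of the affine space of 3 x 3 matrices over an
  algebraically closed field. Note that \<open>*\<close> and \<open>^\<close> on the type of matrices are
  componentwise; matrix multiplication is \<open>**\<close>.\<close>

type_synonym 'k mat3 = "'k^3^3"

inductive_set polyfun :: "('k::field mat3 \<Rightarrow> 'k) set" where
  const: "(\<lambda>_. c) \<in> polyfun"
| coord: "(\<lambda>g. g $ i $ j) \<in> polyfun"
| add: "F \<in> polyfun \<Longrightarrow> F' \<in> polyfun \<Longrightarrow> (\<lambda>g. F g + F' g) \<in> polyfun"
| mult: "F \<in> polyfun \<Longrightarrow> F' \<in> polyfun \<Longrightarrow> (\<lambda>g. F g * F' g) \<in> polyfun"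

definition zclosure :: "'k::field mat3 set \<Rightarrow> 'k mat3 set" where
  "zclosure S = {g. \<forall>F\<in>polyfun. (\<forall>h\<in>S. F h = 0) \<longrightarrow> F g = 0}"

definition zclosed :: "'k::field mat3 set \<Rightarrow> bool" where
  "zclosed S \<longleftrightarrow> zclosure S = S"

definition zconnected :: "'k::field mat3 set \<Rightarrow> bool" where
  "zconnected S \<longleftrightarrow> (\<nexists>C D. zclosed C \<and> zclosed D \<and> C \<noteq> {} \<and> D \<noteq> {} \<and> C \<inter> D = {} \<and> C \<union> D = S)"

text \<open>The regular functions on a closed set \<open>Z\<close>, extended by \<open>0\<close> outside \<open>Z\<close>.\<close>

definition regular :: "'k::field mat3 set \<Rightarrow> ('k mat3 \<Rightarrow> 'k) set" where
  "regular Z = {\<lambda>g. if g \<in> Z then F g else 0 | F. F \<in> polyfun}"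

text \<open>Derivative of a polynomial function \<open>F\<close> at \<open>g\<close> in direction \<open>v\<close>: the coefficient of \<open>t\<close> in
  \<open>F (g + t v)\<close>. The polynomial \<open>q\<close> is unique because the field will be infinite.\<close>

definition dderiv :: "('k::field mat3 \<Rightarrow> 'k) \<Rightarrow> 'k mat3 \<Rightarrow> 'k mat3 \<Rightarrow> 'k" where
  "dderiv F g v = coeff (THE q. \<forall>t. poly q t = F (g + map_matrix ((*) t) v)) 1"

text \<open>Lie algebra of a closed matrix group: the tangent space at the identity.\<close>

definition lie :: "'k::field mat3 set \<Rightarrow> 'k mat3 set" where
  "lie H = {x. \<forall>F\<in>polyfun. (\<forall>h\<in>H. F h = 0) \<longrightarrow> dderiv F (mat 1) x = 0}"

definition matpow :: "'k::field mat3 \<Rightarrow> nat \<Rightarrow> 'k mat3" where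
  "matpow A n = ((**) A ^^ n) (mat 1)"


section \<open>The group and its subgroups\<close>

definition SL3 :: "'k::field mat3 set" where
  "SL3 = {g. det g = 1}"

text \<open>The torus is the diagonal one, \<open>\<alpha> = \<epsilon>\<^sub>1 - \<epsilon>\<^sub>2\<close> and \<open>\<beta> = \<epsilon>\<^sub>2 - \<epsilon>\<^sub>3\<close>. The negative
  Borel subgroup consists of the lower triangular matrices.\<close>

definition Borel :: "'k::field mat3 set" where
  "Borel = {g\<in>SL3. g$1$2 = 0 \<and> g$1$3 = 0 \<and> g$2$3 = 0}"

definition P_alpha :: "'k::field mat3 set" where
  "P_alpha = {g\<in>SL3. g$1$3 = 0 \<and> g$2$3 = 0}"

definition P_beta :: "'k::field mat3 set" where
  "P_beta = {g\<in>SL3. g$1$2 = 0 \<and> g$1$3 = 0}"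

definition unipotent :: "'k::field mat3 \<Rightarrow> bool" where
  "unipotent g \<longleftrightarrow> (\<exists>n. matpow (g - mat 1) n = 0)"

definition normal_subgroup :: "'k::field mat3 set \<Rightarrow> 'k mat3 set \<Rightarrow> bool" where
  "normal_subgroup N H \<longleftrightarrow> N \<subseteq> H \<and> mat 1 \<in> N \<and>
     (\<forall>x\<in>N. \<forall>y\<in>N. x ** y \<in> N) \<and> (\<forall>x\<in>N. matrix_inv x \<in> N) \<and>
     (\<forall>h\<in>H. \<forall>x\<in>N. h ** x ** matrix_inv h \<in> N)"

text \<open>There is a largest closed connected normal unipotent subgroup, hence it is the union of all
  of them.\<close>

definition unipotent_radical :: "'k::field mat3 set \<Rightarrow> 'k mat3 set" where
  "unipotent_radical H =
     \<Union>{N. normal_subgroup N H \<and> zclosed N \<and> zconnected N \<and> (\<forall>g\<in>N. unipotent g)}"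

definition s_alpha :: "'k::field mat3" where
  "s_alpha = vector [vector [0, 1, 0], vector [-1, 0, 0], vector [0, 0, 1]]"

definition s_beta :: "'k::field mat3" where
  "s_beta = vector [vector [1, 0, 0], vector [0, 0, 1], vector [0, -1, 0]]"


section \<open>Weights and sections of line bundles\<close>

definition dominant :: "int \<times> int \<Rightarrow> bool" where
  "dominant lam \<longleftrightarrow> fst lam \<ge> 0 \<and> snd lam \<ge> 0"

text \<open>The weight \<open>(\<lambda>\<^sub>1, \<lambda>\<^sub>2) = \<lambda>\<^sub>1 \<omega>\<^sub>1 + \<lambda>\<^sub>2 \<omega>\<^sub>2\<close> as a character of the Borel subgroup, where
  \<open>\<omega>\<^sub>1 = \<epsilon>\<^sub>1\<close> and \<open>\<omega>\<^sub>2 = \<epsilon>\<^sub>1 + \<epsilon>\<^sub>2\<close>.\<close>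

definition weight_char :: "int \<times> int \<Rightarrow> 'k::field mat3 \<Rightarrow> 'k" where
  "weight_char lam b = (b$1$1) powi fst lam * (b$1$1 * b$2$2) powi snd lam"

text \<open>For a closed \<open>Z \<subseteq> SL3\<close> stable under right multiplication by the Borel subgroup \<open>B\<close>, these are
  the global sections over \<open>Z/B\<close> of the line bundle attached to \<open>lam\<close>: the regular functions on
  \<open>Z\<close> with \<open>f(gb) = lam(b)\<^sup>-\<^sup>1 f(g)\<close>.\<close>

definition bundle_sections :: "'k::field mat3 set \<Rightarrow> int \<times> int \<Rightarrow> ('k mat3 \<Rightarrow> 'k) set" where
  "bundle_sections Z lam =
     {f \<in> regular Z. \<forall>g\<in>Z. \<forall>b\<in>Borel. f (g ** b) = inverse (weight_char lam b) * f g}"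

text \<open>The preimage in \<open>SL3\<close> of the Schubert variety \<open>X(w)\<close>; since the projection to the flag variety
  is open, this is the closure of the double coset. A Weyl group element is given by a
  representative in \<open>SL3\<close>.\<close>

definition schubert :: "'k::field mat3 \<Rightarrow> 'k mat3 set" where
  "schubert w = zclosure {b ** w ** b' | b b'. b \<in> Borel \<and> b' \<in> Borel}"

text \<open>A group \<open>H\<close> whose left multiplication preserves \<open>Z\<close> acts on functions on \<open>Z\<close> by
  \<open>(h f)(g) = f(h\<^sup>-\<^sup>1 g)\<close>. This is the differential of that action: for \<open>x\<close> in the Lie algebra of
  \<open>H\<close>, \<open>(x f)(g)\<close> is the derivative in direction \<open>- x g\<close> of \<open>f\<close> at \<open>g\<close>, computed with any
  polynomial extension \<open>F\<close> of \<open>f\<close>.\<close>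

definition lie_act :: "'k::field mat3 set \<Rightarrow> 'k mat3 \<Rightarrow> ('k mat3 \<Rightarrow> 'k) \<Rightarrow> ('k mat3 \<Rightarrow> 'k)" where
  "lie_act Z x f = (\<lambda>g. if g \<in> Z
     then THE c. \<forall>F\<in>polyfun. (\<forall>z\<in>Z. F z = f z) \<longrightarrow> dderiv F g (- (x ** g)) = c
     else 0)"


section \<open>Support varieties\<close>

definition klinear_on :: "('a \<Rightarrow> 'k::field) set \<Rightarrow> (('a \<Rightarrow> 'k) \<Rightarrow> ('b \<Rightarrow> 'k)) \<Rightarrow> bool" where
  "klinear_on M f \<longleftrightarrow> (\<forall>u\<in>M. \<forall>v\<in>M. \<forall>a b.
     f (\<lambda>i. a * u i + b * v i) = (\<lambda>j. a * f u j + b * f v j))"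

text \<open>The free module of rank \<open>n\<close> over \<open>k[x]/(x^p)\<close>: \<open>v (i, j)\<close> is the coefficient of \<open>x^j\<close> in the
  \<open>i\<close>-th component.\<close>

definition free_module :: "nat \<Rightarrow> nat \<Rightarrow> (nat \<times> nat \<Rightarrow> 'k::field) set" where
  "free_module p n = {v. \<forall>i j. \<not> (i < n \<and> j < p) \<longrightarrow> v (i, j) = 0}"

definition free_act :: "nat \<Rightarrow> (nat \<times> nat \<Rightarrow> 'k::field) \<Rightarrow> (nat \<times> nat \<Rightarrow> 'k)" where
  "free_act p v = (\<lambda>(i, j). if 0 < j \<and> j < p then v (i, j - 1) else 0)"

text \<open>Projectivity over \<open>k[x]/(x^p)\<close> of a finite-dimensional space \<open>M\<close> on which \<open>x\<close> acts by \<open>X\<close>: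
  \<open>M\<close> is a direct summand of a free module, which can be taken of finite rank.\<close>

definition projective :: "nat \<Rightarrow> ('a \<Rightarrow> 'k::field) set \<Rightarrow> (('a \<Rightarrow> 'k) \<Rightarrow> ('a \<Rightarrow> 'k)) \<Rightarrow> bool" where
  "projective p M X \<longleftrightarrow> (\<exists>n \<iota> \<pi>.
     \<iota> ` M \<subseteq> free_module p n \<and> \<pi> ` free_module p n \<subseteq> M \<and>
     klinear_on M \<iota> \<and> klinear_on (free_module p n) \<pi> \<and>
     (\<forall>m\<in>M. \<iota> (X m) = free_act p (\<iota> m)) \<and>
     (\<forall>v\<in>free_module p n. \<pi> (free_act p v) = X (\<pi> v)) \<and>
     (\<forall>m\<in>M. \<pi> (\<iota> m) = m))"

text \<open>The \<open>p\<close>-operation on a matrix Lie algebra is the \<open>p\<close>-th matrix power.\<close>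

definition N1 :: "nat \<Rightarrow> 'k::field mat3 set \<Rightarrow> 'k mat3 set" where
  "N1 p L = {x\<in>L. matpow x p = 0}"

text \<open>The support variety over the first Frobenius kernel of \<open>H\<close> of the \<open>H\<close>-module of sections over
  \<open>Z/B\<close>, where left multiplication by \<open>H\<close> preserves \<open>Z\<close>, as a subset of the restricted nullcone
  of the Lie algebra of \<open>H\<close>.\<close>

definition support_variety ::
  "nat \<Rightarrow> 'k::field mat3 set \<Rightarrow> 'k mat3 set \<Rightarrow> int \<times> int \<Rightarrow> 'k mat3 set" where
  "support_variety p H Z lam =
     {x \<in> N1 p (lie H). \<not> projective p (bundle_sections Z lam) (lie_act Z x)} \<union> {0}"

end

theory Submission
  imports Defs
begin

text \<open>The Borel subgroup is lower triangular, so \<open>u\<close> is the space of strictly lower triangular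
  matrices; as \<open>p \<ge> 3\<close> it is the restricted nullcone of the Lie algebra of the Borel subgroup
  (\<open>N1_lie_Borel\<close>). Each claim asks for which \<open>x\<close> in \<open>u\<close> a module of sections is projective over
  \<open>k[x]/(x^p)\<close>.

  For \<open>w = e\<close> the module is one-dimensional, so it is never projective. For \<open>w = s_alpha\<close> the
  preimage of the Schubert variety is \<open>P_alpha\<close>, and its quotient by the Borel subgroup is a
  projective line with homogeneous coordinates \<open>A = g$1$2\<close> and \<open>B = g$2$2\<close>. The sections are spanned
  by \<open>A\<^sup>i B\<^sup>l\<^sup>-\<^sup>i C\<close> for \<open>0 \<le> i \<le> l\<close>, with \<open>l = \<lambda>\<^sub>1\<close> and a fixed factor \<open>C\<close> that \<open>u\<close> does not move
  (\<open>section_lincomb\<close>). Left multiplication by \<open>1 - t x\<close> fixes \<open>A\<close> and sends \<open>B\<close> to \<open>B - t a A\<close> with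
  \<open>a = x$2$1\<close>. Hence \<open>x\<close> sends the \<open>i\<close>-th section to \<open>- a (l - i)\<close> times the next one, and such a
  string is projective exactly when \<open>a \<noteq> 0\<close> and \<open>p\<close> divides \<open>l + 1\<close> (\<open>projective_string_iff\<close>). The
  locus \<open>a = 0\<close> in \<open>u\<close> is the Lie algebra of the unipotent radical of \<open>P_alpha\<close>. The case of \<open>s_beta\<close>
  is the same computation with the lower right block; both are instances of the locale
  \<open>line_bundle\<close>.

  For the longest element, the big cell is dense, so the preimage of the Schubert variety is the
  whole group (\<open>schubert_longest\<close>). The modules on both sides of the last claim then coincide,
  together with the action of \<open>u\<close>.

  Two geometric inputs are made elementary. Closures of double cosets are found by moving a point
  along a polynomial curve into the open cell (\<open>zclosure_eqI_curves\<close>). The unipotent radicals of the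
  parabolics are found by bounding the normal subgroups of unipotent elements with a trace
  computation in the Levi factor (\<open>unipotent_radical_P_alpha\<close>).\<close>

section \<open>Polynomial curves and Zariski closures\<close>

text \<open>If the field were finite, \<open>1\<close> plus the product of all \<open>X - a\<close> would have no root.\<close>

lemma infinite_alg_closed: "infinite (UNIV :: 'k::alg_closed_field set)"
proof
  assume fin: "finite (UNIV :: 'k set)"
  define q :: "'k poly" where "q = (\<Prod>a\<in>UNIV. [:- a, 1:]) + 1"
  have "degree (\<Prod>a\<in>(UNIV :: 'k set). [:- a, 1:]) = card (UNIV :: 'k set)"
    by (subst degree_prod_eq_sum_degree) auto
  moreover have "card (UNIV :: 'k set) > 0"
    using fin by (simp add: card_gt_0_iff)
  ultimately have "degree q > 0"
    unfolding q_def by (subst degree_add_eq_left) auto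
  then obtain x where "poly q x = 0"
    using alg_closed_imp_poly_has_root by blast
  moreover have "(\<Prod>a\<in>UNIV. x - a) = 0"
    using fin by (intro prod_zero) auto
  ultimately show False
    by (simp add: q_def poly_prod)
qed

lemma poly_eqI_cofinite:
  fixes q r :: "'k::alg_closed_field poly"
  assumes "finite A" and "\<And>t. t \<notin> A \<Longrightarrow> poly q t = poly r t"
  shows "q = r"
proof (rule ccontr)
  assume "q \<noteq> r"
  then have "finite {t. poly (q - r) t = 0}"
    by (intro poly_roots_finite) auto
  moreover have "UNIV \<subseteq> A \<union> {t. poly (q - r) t = 0}"
    using assms(2) by auto
  ultimately show False
    using \<open>finite A\<close> infinite_alg_closed finite_subset by (metis finite_UnI)
qed

lemma poly_fun_eqI:
  fixes q r :: "'k::alg_closed_field poly"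
  shows "(\<And>t. poly q t = poly r t) \<Longrightarrow> q = r"
  by (rule poly_eqI_cofinite[of "{}"]) auto

text \<open>Everything about the Zariski topology and about tangent directions is reduced to polynomial
  functions of one parameter, by restricting a regular function to a polynomial curve of matrices.\<close>

definition is_poly :: "('k::field \<Rightarrow> 'k) \<Rightarrow> bool" where
  "is_poly f \<longleftrightarrow> (\<exists>q. \<forall>t. f t = poly q t)"

named_theorems is_poly_intros

lemma is_poly_basic [is_poly_intros]:
  "is_poly (\<lambda>t. c)" "is_poly (\<lambda>t. t)"
  unfolding is_poly_def by (rule exI[of _ "[:c:]"], simp) (rule exI[of _ "[:0, 1:]"], simp)

lemma is_poly_arith [is_poly_intros]:
  assumes "is_poly f" "is_poly g"
  shows "is_poly (\<lambda>t. f t + g t)" "is_poly (\<lambda>t. f t * g t)"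
  using assms unfolding is_poly_def by (metis poly_add, metis poly_mult)

lemma is_poly_power [is_poly_intros]: "is_poly f \<Longrightarrow> is_poly (\<lambda>t. f t ^ n)"
  unfolding is_poly_def by (metis poly_power)

lemma polyfun_is_poly:
  assumes "F \<in> polyfun" and "\<And>i j. is_poly (\<lambda>t. c t $ i $ j)"
  shows "is_poly (\<lambda>t. F (c t))"
  using assms(1) by induction (auto intro: is_poly_intros assms(2))

lemma polyfun_line: "F \<in> polyfun \<Longrightarrow> is_poly (\<lambda>t. F (g + map_matrix ((*) t) v))"
  unfolding map_matrix_def
  by (erule polyfun_is_poly, unfold vector_add_component vec_lambda_beta) (intro is_poly_intros)

lemma dderiv_eqI:
  fixes F :: "'k::alg_closed_field mat3 \<Rightarrow> 'k"
  assumes "\<And>t. F (g + map_matrix ((*) t) v) = poly q t"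
  shows "dderiv F g v = coeff q 1"
proof -
  have "(THE q. \<forall>t. poly q t = F (g + map_matrix ((*) t) v)) = q"
    using assms by (intro the_equality) (auto intro: poly_fun_eqI)
  then show ?thesis by (simp add: dderiv_def)
qed

lemma polyfun_uminus: "F \<in> polyfun \<Longrightarrow> (\<lambda>g. - F g) \<in> polyfun"
  using polyfun.mult[OF polyfun.const[of "-1"], of F] by simp

lemma polyfun_diff: "F \<in> polyfun \<Longrightarrow> F' \<in> polyfun \<Longrightarrow> (\<lambda>g. F g - F' g) \<in> polyfun"
  using polyfun.add[OF _ polyfun_uminus, of F F'] by simp

lemma polyfun_power: "F \<in> polyfun \<Longrightarrow> (\<lambda>g. F g ^ n) \<in> polyfun"
  by (induction n) (auto intro: polyfun.const polyfun.mult)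

lemma polyfun_sum: "(\<And>i. i \<in> I \<Longrightarrow> F i \<in> polyfun) \<Longrightarrow> (\<lambda>g. \<Sum>i\<in>I. F i g) \<in> polyfun"
  by (induction I rule: infinite_finite_induct) (auto intro: polyfun.const polyfun.add)

lemmas polyfun_intros = polyfun.intros polyfun_uminus polyfun_diff polyfun_power polyfun_sum

lemma polyfun_det: "(\<lambda>g. det g) \<in> polyfun"
  unfolding det_3 by (intro polyfun_intros)

lemma subset_zclosure: "S \<subseteq> zclosure S"
  by (auto simp: zclosure_def)

lemma zclosure_mono: "S \<subseteq> S' \<Longrightarrow> zclosure S \<subseteq> zclosure S'"
  unfolding zclosure_def by blast

lemma zclosedI:
  assumes "\<And>g. g \<notin> S \<Longrightarrow> \<exists>F\<in>polyfun. (\<forall>h\<in>S. F h = 0) \<and> F g \<noteq> 0"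
  shows "zclosed S"
  using assms subset_zclosure[of S] unfolding zclosed_def zclosure_def by blast

lemma zclosed_Int: "zclosed S \<Longrightarrow> zclosed S' \<Longrightarrow> zclosed (S \<inter> S')"
  unfolding zclosed_def using zclosure_mono[of "S \<inter> S'" S] zclosure_mono[of "S \<inter> S'" S']
    subset_zclosure[of "S \<inter> S'"] by auto

lemma zclosed_eq: "F \<in> polyfun \<Longrightarrow> zclosed {g. F g = c}"
  by (rule zclosedI) (auto intro!: bexI[of _ "\<lambda>g. F g - c"] polyfun_intros)

text \<open>The criterion for density: every point of \<open>Z\<close> is the value at \<open>0\<close> of a polynomial curve
  that lies in \<open>S\<close> wherever an auxiliary polynomial \<open>r\<close> does not vanish. A regular function that
  vanishes on \<open>S\<close> then vanishes along the curve up to finitely many parameters, hence at \<open>0\<close>.\<close>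

lemma zclosure_eqI_curves:
  fixes Z :: "'k::alg_closed_field mat3 set"
  assumes "zclosed Z" and "S \<subseteq> Z"
    and curve: "\<And>z. z \<in> Z \<Longrightarrow> \<exists>c r. (\<forall>i j. is_poly (\<lambda>t. c t $ i $ j)) \<and> c 0 = z \<and>
      is_poly r \<and> (\<exists>t. r t \<noteq> 0) \<and> (\<forall>t. r t \<noteq> 0 \<longrightarrow> c t \<in> S)"
  shows "zclosure S = Z"
proof
  show "zclosure S \<subseteq> Z"
    using zclosure_mono[OF assms(2)] assms(1) by (simp add: zclosed_def)
  show "Z \<subseteq> zclosure S"
  proof (unfold zclosure_def, safe)
    fix z F assume z: "z \<in> Z" and F: "F \<in> polyfun" "\<forall>h\<in>S. F h = 0"
    from curve[OF z] obtain c r where c: "\<And>i j. is_poly (\<lambda>t. c t $ i $ j)" "c 0 = z" "is_poly r"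
        "\<exists>t. r t \<noteq> 0" "\<And>t. r t \<noteq> 0 \<Longrightarrow> c t \<in> S"
      by blast
    obtain R where R: "\<And>t. r t = poly R t" using c(3) by (auto simp: is_poly_def)
    obtain q where q: "\<And>t. F (c t) = poly q t"
      using polyfun_is_poly[OF F(1) c(1)] by (auto simp: is_poly_def)
    have "R \<noteq> 0" using c(4) R by auto
    have "q = 0"
    proof (rule poly_eqI_cofinite[OF poly_roots_finite[OF \<open>R \<noteq> 0\<close>]])
      fix t assume "t \<notin> {t. poly R t = 0}"
      then have "c t \<in> S" using c(5) R by simp
      then show "poly q t = poly 0 t" using F(2) q by (metis poly_0)
    qed
    then show "F z = 0" using q[of 0] c(2) by simp
  qed
qed

section \<open>Matrices of size three\<close>

lemma mat3_eq_iff: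
  fixes A B :: "'k mat3"
  shows "A = B \<longleftrightarrow> A$1$1 = B$1$1 \<and> A$1$2 = B$1$2 \<and> A$1$3 = B$1$3 \<and> A$2$1 = B$2$1 \<and>
    A$2$2 = B$2$2 \<and> A$2$3 = B$2$3 \<and> A$3$1 = B$3$1 \<and> A$3$2 = B$3$2 \<and> A$3$3 = B$3$3"
  by (auto simp: vec_eq_iff forall_3)

lemma mult3_nth:
  fixes A B :: "'k::field mat3"
  shows "(A ** B) $ i $ j = A$i$1 * B$1$j + A$i$2 * B$2$j + A$i$3 * B$3$j"
  by (simp add: matrix_matrix_mult_def sum_3)

lemma index_neq: "(1::3) \<noteq> 2" "(2::3) \<noteq> 1" "(1::3) \<noteq> 3" "(3::3) \<noteq> 1" "(2::3) \<noteq> 3" "(3::3) \<noteq> 2"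
  by simp_all

lemma mat1_nth: "(mat 1 :: 'k::field mat3) $ i $ j = (if i = j then 1 else 0)"
  by (simp add: mat_def)

lemma scale_nth: "map_matrix ((*) t) A $ i $ j = (t::'k::field) * A $ i $ j"
  by (simp add: map_matrix_def)

definition M3 :: "'k \<Rightarrow> 'k \<Rightarrow> 'k \<Rightarrow> 'k \<Rightarrow> 'k \<Rightarrow> 'k \<Rightarrow> 'k \<Rightarrow> 'k \<Rightarrow> 'k \<Rightarrow> 'k::field mat3" where
  "M3 a b c d e f g h i = vector [vector [a, b, c], vector [d, e, f], vector [g, h, i]]"

lemma M3_nth [simp]:
  "M3 a b c d e f g h i $ 1 $ 1 = a" "M3 a b c d e f g h i $ 1 $ 2 = b"
  "M3 a b c d e f g h i $ 1 $ 3 = c" "M3 a b c d e f g h i $ 2 $ 1 = d"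
  "M3 a b c d e f g h i $ 2 $ 2 = e" "M3 a b c d e f g h i $ 2 $ 3 = f"
  "M3 a b c d e f g h i $ 3 $ 1 = g" "M3 a b c d e f g h i $ 3 $ 2 = h"
  "M3 a b c d e f g h i $ 3 $ 3 = i"
  by (simp_all add: M3_def)

lemmas mat3_simps = mat3_eq_iff mult3_nth mat1_nth scale_nth det_3

text \<open>The adjugate. On \<open>SL3\<close> it is the inverse, with entries polynomial in those of \<open>g\<close>, so that
  conjugation becomes a computation with entries.\<close>

definition adj3 :: "'k::field mat3 \<Rightarrow> 'k mat3" where
  "adj3 g = M3
     (g$2$2 * g$3$3 - g$2$3 * g$3$2) (g$1$3 * g$3$2 - g$1$2 * g$3$3) (g$1$2 * g$2$3 - g$1$3 * g$2$2)
     (g$2$3 * g$3$1 - g$2$1 * g$3$3) (g$1$1 * g$3$3 - g$1$3 * g$3$1) (g$1$3 * g$2$1 - g$1$1 * g$2$3)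
     (g$2$1 * g$3$2 - g$2$2 * g$3$1) (g$1$2 * g$3$1 - g$1$1 * g$3$2) (g$1$1 * g$2$2 - g$1$2 * g$2$1)"

lemma adj3_det: "g ** adj3 g = mat (det g)" "adj3 g ** g = mat (det g)"
  unfolding adj3_def mat_def det_3 mat3_eq_iff mult3_nth M3_nth vec_lambda_beta
  by (simp_all add: algebra_simps)

lemma adj3_inverse:
  assumes "g \<in> SL3"
  shows "g ** adj3 g = mat 1" "adj3 g ** g = mat 1"
  using assms by (simp_all add: adj3_det SL3_def)

lemma matrix_inv_SL3: "g \<in> SL3 \<Longrightarrow> matrix_inv g = adj3 g"
proof -
  assume g: "g \<in> SL3"
  have "g ** matrix_inv g = mat 1"
    unfolding matrix_inv_def by (rule someI2[of _ "adj3 g"]) (use adj3_inverse[OF g] in auto)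
  then have "adj3 g ** (g ** matrix_inv g) = adj3 g" by simp
  then show ?thesis by (simp add: matrix_mul_assoc adj3_inverse[OF g])
qed

lemma SL3_mult: "g \<in> SL3 \<Longrightarrow> h \<in> SL3 \<Longrightarrow> g ** h \<in> SL3"
  by (simp add: SL3_def det_mul)

section \<open>Unipotent radicals and their Lie algebras\<close>

text \<open>The unipotent radicals of the three groups are all of the form \<open>1 + low I\<close>, where \<open>low I\<close>
  consists of the matrices supported on a set \<open>I\<close> of positions below the diagonal: the root spaces of
  the nilradical. The three index sets belong to the Borel subgroup and to the two parabolics.\<close>

definition low :: "(3 \<times> 3) set \<Rightarrow> 'k::field mat3 set" where
  "low I = {x. \<forall>i j. (i, j) \<notin> I \<longrightarrow> x $ i $ j = 0}"

definition uni :: "(3 \<times> 3) set \<Rightarrow> 'k::field mat3 set" where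
  "uni I = {g. g - mat 1 \<in> low I}"

abbreviation I_B :: "(3 \<times> 3) set" where "I_B \<equiv> {(2,1), (3,1), (3,2)}"
abbreviation I_alpha :: "(3 \<times> 3) set" where "I_alpha \<equiv> {(3,1), (3,2)}"
abbreviation I_beta :: "(3 \<times> 3) set" where "I_beta \<equiv> {(2,1), (3,1)}"

lemma low_iff:
  "x \<in> low I_B \<longleftrightarrow> x$1$1 = 0 \<and> x$1$2 = 0 \<and> x$1$3 = 0 \<and> x$2$2 = 0 \<and> x$2$3 = 0 \<and> x$3$3 = 0"
  "x \<in> low I_alpha \<longleftrightarrow> x \<in> low I_B \<and> x$2$1 = 0"
  "x \<in> low I_beta \<longleftrightarrow> x \<in> low I_B \<and> x$3$2 = 0"
  unfolding low_def mem_Collect_eq forall_3 by (auto simp: index_neq)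

lemma uni_iff:
  "g \<in> uni I_B \<longleftrightarrow> g$1$1 = 1 \<and> g$1$2 = 0 \<and> g$1$3 = 0 \<and> g$2$2 = 1 \<and> g$2$3 = 0 \<and> g$3$3 = 1"
  "g \<in> uni I_alpha \<longleftrightarrow> g \<in> uni I_B \<and> g$2$1 = 0"
  "g \<in> uni I_beta \<longleftrightarrow> g \<in> uni I_B \<and> g$3$2 = 0"
  unfolding uni_def mem_Collect_eq low_iff by (auto simp: mat1_nth index_neq)

lemma uni_line: "x \<in> low I \<Longrightarrow> mat 1 + map_matrix ((*) t) x \<in> uni I"
  by (simp add: uni_def low_def scale_nth)

lemma uni_segment:
  assumes "g \<in> uni I" "h \<in> uni I" shows "g + map_matrix ((*) t) (h - g) \<in> uni I"
  using assms by (simp add: uni_def low_def scale_nth)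

lemma uni_mono: "I \<subseteq> J \<Longrightarrow> uni I \<subseteq> uni J"
  unfolding uni_def low_def by blast

lemma zclosed_uni: "zclosed (uni I)"
proof (rule zclosedI)
  fix g :: "'a mat3" assume "g \<notin> uni I"
  then obtain i j where "(i, j) \<notin> I" "g $ i $ j - mat 1 $ i $ j \<noteq> 0"
    unfolding uni_def low_def by auto
  then show "\<exists>F\<in>polyfun. (\<forall>h\<in>uni I. F h = 0) \<and> F g \<noteq> 0"
    by (intro bexI[of _ "\<lambda>g. g $ i $ j - mat 1 $ i $ j"] polyfun_intros)
      (auto simp: uni_def low_def)
qed

lemma zclosed_separate:
  assumes "zclosed C" "g \<notin> C"
  obtains F where "F \<in> polyfun" "\<forall>h\<in>C. F h = 0" "F g \<noteq> 0"
  using assms unfolding zclosed_def zclosure_def by blast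

text \<open>If two disjoint closed sets covered \<open>S\<close>, take a function for each that vanishes on it but
  not at some chosen point of the other. On the line through the two points the product of the
  functions is the zero polynomial, although neither factor is.\<close>

lemma zconnected_if_segments:
  fixes S :: "'k::alg_closed_field mat3 set"
  assumes "\<And>g h t. g \<in> S \<Longrightarrow> h \<in> S \<Longrightarrow> g + map_matrix ((*) t) (h - g) \<in> S"
  shows "zconnected S"
  unfolding zconnected_def
proof (rule notI, elim exE conjE)
  fix C D :: "'k mat3 set"
  assume C: "zclosed C" and D: "zclosed D" and CD: "C \<inter> D = {}" "C \<union> D = S"
    and "C \<noteq> {}" "D \<noteq> {}"
  then obtain g h where g: "g \<in> C" and h: "h \<in> D" by blast
  have "g \<notin> D" "h \<notin> C" using CD g h by auto
  obtain F where F: "F \<in> polyfun" "\<forall>h\<in>C. F h = 0" "F h \<noteq> 0"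
    using zclosed_separate[OF C \<open>h \<notin> C\<close>] .
  obtain F' where F': "F' \<in> polyfun" "\<forall>h\<in>D. F' h = 0" "F' g \<noteq> 0"
    using zclosed_separate[OF D \<open>g \<notin> D\<close>] .
  define c where "c t = g + map_matrix ((*) t) (h - g)" for t
  have c: "c 0 = g" "c 1 = h" "\<And>t. c t \<in> C \<union> D"
    using assms[of g h] g h CD(2) by (auto simp: c_def mat3_simps)
  obtain q where q: "\<And>t. F (c t) = poly q t"
    using polyfun_line[OF F(1)] unfolding is_poly_def c_def by metis
  obtain q' where q': "\<And>t. F' (c t) = poly q' t"
    using polyfun_line[OF F'(1)] unfolding is_poly_def c_def by metis
  have "poly (q * q') t = poly 0 t" for t
    using c(3)[of t] F(2) F'(2) by (auto simp flip: q q')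
  then have "q * q' = 0" by (rule poly_fun_eqI)
  moreover have "q \<noteq> 0" using F(3) q[of 1] c(2) by auto
  moreover have "q' \<noteq> 0" using F'(3) q'[of 0] c(1) by auto
  ultimately show False by simp
qed

lemma lie_mono: "H \<subseteq> H' \<Longrightarrow> lie H \<subseteq> lie H'"
  unfolding lie_def by blast

lemma lie_entry_0:
  fixes H :: "'k::alg_closed_field mat3 set"
  assumes "x \<in> lie H" and "\<And>h. h \<in> H \<Longrightarrow> h $ i $ j = mat 1 $ i $ j"
  shows "x $ i $ j = 0"
proof -
  let ?F = "\<lambda>g::'k mat3. g $ i $ j - mat 1 $ i $ j"
  have "?F \<in> polyfun" by (intro polyfun_intros)
  then have "dderiv ?F (mat 1) x = 0"
    using assms unfolding lie_def by auto
  moreover have "dderiv ?F (mat 1) x = coeff [:0, x $ i $ j:] 1"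
    by (rule dderiv_eqI) (simp add: scale_nth)
  ultimately show ?thesis by simp
qed

text \<open>As \<open>uni I\<close> is an affine space through the identity, its tangent space is its direction: the
  equations of \<open>uni I\<close> bound the tangent space from above, the lines in \<open>uni I\<close> from below.\<close>

lemma lie_uni: "lie (uni I :: 'k::alg_closed_field mat3 set) = low I"
proof
  show "lie (uni I) \<subseteq> (low I :: 'k mat3 set)"
  proof
    fix x :: "'k mat3" assume "x \<in> lie (uni I)"
    then show "x \<in> low I"
      unfolding low_def by (auto intro!: lie_entry_0 simp: uni_def low_def)
  qed
  show "(low I :: 'k mat3 set) \<subseteq> lie (uni I)"
  proof
    fix x :: "'k mat3" assume x: "x \<in> low I"
    have "dderiv F (mat 1) x = coeff 0 1" if "\<forall>h\<in>uni I. F h = 0" for F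
      by (rule dderiv_eqI) (use that uni_line[OF x] in auto)
    then show "x \<in> lie (uni I)" by (simp add: lie_def)
  qed
qed

lemma matpow_Suc: "matpow A (Suc n) = A ** matpow A n"
  by (simp add: matpow_def)

lemma matpow_0: "matpow A 0 = mat 1"
  by (simp add: matpow_def)

lemma matpow_low:
  assumes "x \<in> low I_B" "n \<ge> 3" shows "matpow x n = 0"
proof -
  have "matpow x (m + 3) = 0" for m
    using assms(1) by (induction m)
      (simp_all add: matpow_Suc matpow_0 numeral_3_eq_3 low_iff mat3_simps)
  then show ?thesis using assms(2) by (metis le_add_diff_inverse2)
qed

lemma low_mono: "I \<subseteq> J \<Longrightarrow> low I \<subseteq> low J"
  unfolding low_def by blast

lemma uni_subset_SL3: "I \<subseteq> I_B \<Longrightarrow> uni I \<subseteq> SL3"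
  using uni_mono[of I I_B] by (auto simp: uni_iff SL3_def det_3)

lemma unipotent_uni: "I \<subseteq> I_B \<Longrightarrow> g \<in> uni I \<Longrightarrow> unipotent g"
  unfolding unipotent_def uni_def using matpow_low[of "g - mat 1" 3] low_mono[of I I_B] by auto

lemma nilpotent_lower_diag:
  fixes A :: "'k::field mat3"
  assumes "matpow A n = 0" "A$1$2 = 0" "A$1$3 = 0" "A$2$3 = 0"
  shows "A$1$1 = 0 \<and> A$2$2 = 0 \<and> A$3$3 = 0"
proof -
  have "matpow A m $1$2 = 0 \<and> matpow A m $1$3 = 0 \<and> matpow A m $2$3 = 0 \<and>
    matpow A m $1$1 = (A$1$1)^m \<and> matpow A m $2$2 = (A$2$2)^m \<and> matpow A m $3$3 = (A$3$3)^m" for m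
    by (induction m) (use assms in \<open>simp_all add: matpow_0 matpow_Suc mat3_simps\<close>)
  from this[of n] assms(1) show ?thesis by simp
qed

text \<open>A nilpotent \<open>2 \<times> 2\<close> matrix \<open>A\<close> has determinant and trace \<open>0\<close>: its determinant is nilpotent,
  and then \<open>A\<^sup>2 = (tr A) A\<close> makes \<open>A\<^sup>n\<^sup>+\<^sup>1\<close> equal to \<open>(tr A)\<^sup>n A\<close>. The four entries of the powers are
  separate sequences in order to apply this to a diagonal block of a \<open>3 \<times> 3\<close> matrix.\<close>

lemma nilpotent_2x2:
  fixes a b c d :: "'k::field" and m11 m12 m21 m22 :: "nat \<Rightarrow> 'k"
  assumes "m11 0 = 1" "m12 0 = 0" "m21 0 = 0" "m22 0 = 1"
    and step: "\<And>n. m11 (Suc n) = a * m11 n + b * m21 n" "\<And>n. m12 (Suc n) = a * m12 n + b * m22 n"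
      "\<And>n. m21 (Suc n) = c * m11 n + d * m21 n" "\<And>n. m22 (Suc n) = c * m12 n + d * m22 n"
    and "m11 n = 0" "m12 n = 0" "m21 n = 0" "m22 n = 0"
  shows "a + d = 0 \<and> a * d - b * c = 0"
proof -
  have "m11 k * m22 k - m12 k * m21 k = (a * d - b * c) ^ k" for k
  proof (induction k)
    case (Suc k)
    have "m11 (Suc k) * m22 (Suc k) - m12 (Suc k) * m21 (Suc k)
        = (a * d - b * c) * (m11 k * m22 k - m12 k * m21 k)"
      unfolding step by (simp add: algebra_simps)
    then show ?case using Suc.IH by simp
  qed (simp add: assms(1-4))
  from this[of n] have det: "a * d - b * c = 0"
    using assms by simp
  have "m11 (Suc k) = (a + d) ^ k * a \<and> m12 (Suc k) = (a + d) ^ k * b \<and>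
    m21 (Suc k) = (a + d) ^ k * c \<and> m22 (Suc k) = (a + d) ^ k * d" for k
  proof (induction k)
    case 0
    then show ?case by (simp add: assms(1-4) step)
  next
    case (Suc k)
    have bc: "b * c = a * d" "c * b = a * d" using det by (simp_all add: mult.commute)
    have "m11 (Suc (Suc k)) = (a + d) ^ k * (a * a + b * c)"
        "m12 (Suc (Suc k)) = (a + d) ^ k * (a * b + b * d)"
        "m21 (Suc (Suc k)) = (a + d) ^ k * (c * a + d * c)"
        "m22 (Suc (Suc k)) = (a + d) ^ k * (c * b + d * d)"
      unfolding step(1)[of "Suc k"] step(2)[of "Suc k"] step(3)[of "Suc k"] step(4)[of "Suc k"]
      using Suc.IH by (simp_all add: algebra_simps)
    then show ?case
      unfolding bc by (simp add: algebra_simps)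
  qed
  moreover obtain k where "n = Suc k"
    using assms by (cases n) auto
  ultimately show ?thesis
    using assms det by (cases "a + d = 0") auto
qed

text \<open>Let \<open>x\<close> be the matrix with rows \<open>(a, b)\<close> and \<open>(c, d)\<close> and let \<open>u\<close> have rows \<open>(1, 1)\<close> and
  \<open>(0, 1)\<close>. The third assumption says that \<open>x\<close> times \<open>u x u\<^sup>-\<^sup>1\<close> has trace \<open>2\<close>. That trace is
  \<open>tr (x\<^sup>2) - c\<^sup>2\<close>, and a unipotent \<open>x\<close> satisfies \<open>tr (x\<^sup>2) = 2\<close>. Together with the transposed argument
  this is why a normal subgroup of \<open>SL2\<close> made of unipotent elements is trivial.\<close>

lemma trace_conjugate_2x2:
  fixes a b c d :: "'k::field"
  assumes "a + d = 2" "a * d - b * c = 1"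
    and "a * (a + c) + b * c + c * (b + d - a - c) + d * (d - c) = 2"
  shows "c = 0"
proof -
  have "c * c = (a + d) * (a + d) - 2 * (a * d - b * c)
      - (a * (a + c) + b * c + c * (b + d - a - c) + d * (d - c))"
    by (simp add: algebra_simps)
  then have "c * c = 0"
    unfolding assms by simp
  then show ?thesis by simp
qed

lemma Borel_iff: "g \<in> Borel \<longleftrightarrow> g$1$1 * g$2$2 * g$3$3 = 1 \<and> g$1$2 = 0 \<and> g$1$3 = 0 \<and> g$2$3 = 0"
  by (auto simp: Borel_def SL3_def det_3)

lemma P_alpha_iff: "g \<in> P_alpha \<longleftrightarrow>
    (g$1$1 * g$2$2 - g$1$2 * g$2$1) * g$3$3 = 1 \<and> g$1$3 = 0 \<and> g$2$3 = 0"
  by (auto simp: P_alpha_def SL3_def det_3 algebra_simps)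

lemma P_beta_iff: "g \<in> P_beta \<longleftrightarrow>
    g$1$1 * (g$2$2 * g$3$3 - g$2$3 * g$3$2) = 1 \<and> g$1$2 = 0 \<and> g$1$3 = 0"
  by (auto simp: P_beta_def SL3_def det_3 algebra_simps)

lemma unipotent_P_alpha:
  assumes "unipotent g" "g \<in> P_alpha"
  shows "g$1$1 + g$2$2 = 2" "g$1$1 * g$2$2 - g$1$2 * g$2$1 = 1"
proof -
  obtain n where n: "matpow (g - mat 1) n = 0"
    using assms(1) by (auto simp: unipotent_def)
  have "(g$1$1 - 1) + (g$2$2 - 1) = 0 \<and> (g$1$1 - 1) * (g$2$2 - 1) - g$1$2 * g$2$1 = 0"
    by (rule nilpotent_2x2[where n = n
      and ?m11.0 = "\<lambda>n. matpow (g - mat 1) n $1$1" and ?m12.0 = "\<lambda>n. matpow (g - mat 1) n $1$2"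
      and ?m21.0 = "\<lambda>n. matpow (g - mat 1) n $2$1" and ?m22.0 = "\<lambda>n. matpow (g - mat 1) n $2$2"])
      (use assms(2) n in \<open>simp_all add: matpow_0 matpow_Suc mult3_nth mat1_nth index_neq P_alpha_iff\<close>)
  then show "g$1$1 + g$2$2 = 2" "g$1$1 * g$2$2 - g$1$2 * g$2$1 = 1"
    by algebra+
qed

lemma unipotent_P_beta:
  assumes "unipotent g" "g \<in> P_beta"
  shows "g$2$2 + g$3$3 = 2" "g$2$2 * g$3$3 - g$2$3 * g$3$2 = 1"
proof -
  obtain n where n: "matpow (g - mat 1) n = 0"
    using assms(1) by (auto simp: unipotent_def)
  have *: "matpow (g - mat 1) n $1$2 = 0 \<and> matpow (g - mat 1) n $1$3 = 0" for n
    by (induction n) (use assms(2) in \<open>simp_all add: matpow_0 matpow_Suc mult3_nth mat1_nth index_neq P_beta_iff\<close>)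
  have "(g$2$2 - 1) + (g$3$3 - 1) = 0 \<and> (g$2$2 - 1) * (g$3$3 - 1) - g$2$3 * g$3$2 = 0"
    by (rule nilpotent_2x2[where n = n
      and ?m11.0 = "\<lambda>n. matpow (g - mat 1) n $2$2" and ?m12.0 = "\<lambda>n. matpow (g - mat 1) n $2$3"
      and ?m21.0 = "\<lambda>n. matpow (g - mat 1) n $3$2" and ?m22.0 = "\<lambda>n. matpow (g - mat 1) n $3$3"])
      (use assms(2) n in \<open>simp_all add: * matpow_0 matpow_Suc mult3_nth mat1_nth index_neq P_beta_iff\<close>)
  then show "g$2$2 + g$3$3 = 2" "g$2$2 * g$3$3 - g$2$3 * g$3$2 = 1"
    by algebra+
qed

lemma mat_sub_distrib:
  fixes A B C :: "'k::field mat3"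
  shows "A ** (B - C) = A ** B - A ** C" "(A - B) ** C = A ** C - B ** C"
  by (simp_all add: mat3_eq_iff mult3_nth algebra_simps)

lemma normal_subgroup_uni:
  fixes H :: "'k::field mat3 set"
  assumes "uni I \<subseteq> H" "H \<subseteq> SL3"
    and "\<And>g h :: 'k mat3. g \<in> uni I \<Longrightarrow> h \<in> uni I \<Longrightarrow> g ** h \<in> uni I"
    and "\<And>g :: 'k mat3. g \<in> uni I \<Longrightarrow> adj3 g \<in> uni I"
    and conj: "\<And>h x. h \<in> H \<Longrightarrow> x \<in> low I \<Longrightarrow> h ** x ** adj3 h \<in> low I"
  shows "normal_subgroup (uni I) H"
proof -
  have "h ** x ** matrix_inv h \<in> uni I" if "h \<in> H" "x \<in> uni I" for h x
  proof -
    have h: "h \<in> SL3" using that(1) assms(2) by auto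
    have "h ** x ** adj3 h - mat 1 = h ** (x - mat 1) ** adj3 h"
      using adj3_inverse(1)[OF h] by (simp add: mat_sub_distrib)
    then show ?thesis
      using conj[of h "x - mat 1"] that by (simp add: matrix_inv_SL3[OF h] uni_def)
  qed
  moreover have "mat 1 \<in> uni I" by (simp add: uni_def low_def)
  moreover have "matrix_inv x \<in> uni I" if "x \<in> uni I" for x :: "'k mat3"
    using that assms(1,2) assms(4)[OF that] matrix_inv_SL3[of x] by auto
  ultimately show ?thesis
    using assms(1,3) unfolding normal_subgroup_def by blast
qed

lemma unipotent_radical_uniI:
  fixes H :: "'k::alg_closed_field mat3 set"
  assumes "normal_subgroup (uni I) H" "I \<subseteq> I_B"
    and "\<And>N. normal_subgroup N H \<Longrightarrow> (\<And>g. g \<in> N \<Longrightarrow> unipotent g) \<Longrightarrow> N \<subseteq> uni I"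
  shows "unipotent_radical H = uni I"
proof
  show "unipotent_radical H \<subseteq> uni I"
    unfolding unipotent_radical_def using assms(3) by blast
  show "uni I \<subseteq> unipotent_radical H"
    unfolding unipotent_radical_def
    using assms(1) zclosed_uni zconnected_if_segments[OF uni_segment] unipotent_uni[OF assms(2)] by blast
qed

lemma parabolic_subset_SL3: "Borel \<subseteq> SL3" "P_alpha \<subseteq> SL3" "P_beta \<subseteq> SL3"
  by (auto simp: Borel_def P_alpha_def P_beta_def)

lemma unipotent_radical_Borel: "unipotent_radical (Borel :: 'k::alg_closed_field mat3 set) = uni I_B"
proof (rule unipotent_radical_uniI)
  show "normal_subgroup (uni I_B) (Borel :: 'k mat3 set)"
  proof (rule normal_subgroup_uni[OF _ parabolic_subset_SL3(1)])
  qed (auto simp: uni_iff Borel_iff low_iff mult3_nth adj3_def)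
  fix N :: "'k mat3 set"
  assume N: "normal_subgroup N Borel" and uni: "\<And>g. g \<in> N \<Longrightarrow> unipotent g"
  show "N \<subseteq> uni I_B"
  proof
    fix g assume g: "g \<in> N"
    then have b: "g \<in> Borel" using N by (auto simp: normal_subgroup_def)
    obtain n where "matpow (g - mat 1) n = 0"
      using uni[OF g] by (auto simp: unipotent_def)
    from nilpotent_lower_diag[OF this] b show "g \<in> uni I_B"
      by (auto simp: uni_iff Borel_iff mat1_nth index_neq)
  qed
qed auto

lemma eq_1_of_sum_prod:
  fixes a d :: "'k::field"
  assumes "d = 2 - a" "a * d = 1" shows "a = 1"
proof -
  have "(a - 1) * (a - 1) = 1 - a * (2 - a)" by (simp add: algebra_simps)
  then show ?thesis using assms by simp
qed

lemma normal_subgroup_conj: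
  fixes H :: "'k::field mat3 set"
  assumes N: "normal_subgroup N H" and H: "H \<subseteq> SL3" and h: "h \<in> H" and x: "x \<in> N"
  shows "x ** (h ** x ** adj3 h) \<in> N"
proof -
  have "matrix_inv h = adj3 h" by (rule matrix_inv_SL3) (use H h in blast)
  then have "h ** x ** adj3 h \<in> N"
    using N h x unfolding normal_subgroup_def by metis
  then show ?thesis
    using N x unfolding normal_subgroup_def by blast
qed

text \<open>A normal subgroup of unipotent elements has trivial image in the Levi factor, because there the
  product of an element with its conjugate under a transvection is again unipotent, so has trace \<open>2\<close>.\<close>

lemma unipotent_radical_P_alpha:
  "unipotent_radical (P_alpha :: 'k::alg_closed_field mat3 set) = uni I_alpha"
proof (rule unipotent_radical_uniI)
  show "normal_subgroup (uni I_alpha) (P_alpha :: 'k mat3 set)"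
  proof (rule normal_subgroup_uni[OF _ parabolic_subset_SL3(2)])
  qed (auto simp: uni_iff P_alpha_iff low_iff mult3_nth adj3_def)
  fix N :: "'k mat3 set"
  assume N: "normal_subgroup N P_alpha" and uni: "\<And>g. g \<in> N \<Longrightarrow> unipotent g"
  show "N \<subseteq> uni I_alpha"
  proof
    fix g assume g: "g \<in> N"
    have P: "x \<in> P_alpha" if "x \<in> N" for x using that N by (auto simp: normal_subgroup_def)
    note tr = unipotent_P_alpha[OF uni P]
    \<comment> \<open>the two elementary transvections of the Levi factor\<close>
    let ?u = "M3 1 1 0 0 1 0 0 0 1 :: 'k mat3" and ?v = "M3 1 0 0 1 1 0 0 0 1 :: 'k mat3"
    have "?u \<in> P_alpha" "?v \<in> P_alpha" by (simp_all add: P_alpha_iff)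
    then have "g ** (?u ** g ** adj3 ?u) \<in> N" "g ** (?v ** g ** adj3 ?v) \<in> N"
      using normal_subgroup_conj[OF N parabolic_subset_SL3(2) _ g] by auto
    note tru = tr(1)[OF this(1) this(1)] and trv = tr(1)[OF this(2) this(2)]
    have zero: "g$1$3 = 0" "g$2$3 = 0" using P[OF g] by (auto simp: P_alpha_iff)
    have "g$2$1 = 0"
      by (rule trace_conjugate_2x2[OF tr[OF g g]])
        (use tru in \<open>simp add: mult3_nth adj3_def zero algebra_simps\<close>)
    moreover have "g$1$2 = 0"
      by (rule trace_conjugate_2x2[of "g$2$2" "g$1$1" "g$2$1"])
        (use tr[OF g g] trv in \<open>simp_all add: mult3_nth adj3_def zero algebra_simps\<close>)
    ultimately have "g$2$2 = 2 - g$1$1" "g$1$1 * g$2$2 = 1" "g$3$3 = 1"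
      using tr[OF g g] P[OF g] by (auto simp: P_alpha_iff algebra_simps)
    moreover from this have "g$1$1 = 1" using eq_1_of_sum_prod by blast
    ultimately show "g \<in> uni I_alpha"
      using \<open>g$2$1 = 0\<close> \<open>g$1$2 = 0\<close> zero by (auto simp: uni_iff)
  qed
qed auto

lemma unipotent_radical_P_beta:
  "unipotent_radical (P_beta :: 'k::alg_closed_field mat3 set) = uni I_beta"
proof (rule unipotent_radical_uniI)
  show "normal_subgroup (uni I_beta) (P_beta :: 'k mat3 set)"
  proof (rule normal_subgroup_uni[OF _ parabolic_subset_SL3(3)])
  qed (auto simp: uni_iff P_beta_iff low_iff mult3_nth adj3_def)
  fix N :: "'k mat3 set"
  assume N: "normal_subgroup N P_beta" and uni: "\<And>g. g \<in> N \<Longrightarrow> unipotent g"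
  show "N \<subseteq> uni I_beta"
  proof
    fix g assume g: "g \<in> N"
    have P: "x \<in> P_beta" if "x \<in> N" for x using that N by (auto simp: normal_subgroup_def)
    note tr = unipotent_P_beta[OF uni P]
    let ?u = "M3 1 0 0 0 1 1 0 0 1 :: 'k mat3" and ?v = "M3 1 0 0 0 1 0 0 1 1 :: 'k mat3"
    have "?u \<in> P_beta" "?v \<in> P_beta" by (simp_all add: P_beta_iff)
    then have "g ** (?u ** g ** adj3 ?u) \<in> N" "g ** (?v ** g ** adj3 ?v) \<in> N"
      using normal_subgroup_conj[OF N parabolic_subset_SL3(3) _ g] by auto
    note tru = tr(1)[OF this(1) this(1)] and trv = tr(1)[OF this(2) this(2)]
    have zero: "g$1$2 = 0" "g$1$3 = 0" using P[OF g] by (auto simp: P_beta_iff)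
    have "g$3$2 = 0"
      by (rule trace_conjugate_2x2[OF tr[OF g g]])
        (use tru in \<open>simp add: mult3_nth adj3_def zero algebra_simps\<close>)
    moreover have "g$2$3 = 0"
      by (rule trace_conjugate_2x2[of "g$3$3" "g$2$2" "g$3$2"])
        (use tr[OF g g] trv in \<open>simp_all add: mult3_nth adj3_def zero algebra_simps\<close>)
    ultimately have "g$3$3 = 2 - g$2$2" "g$2$2 * g$3$3 = 1" "g$1$1 = 1"
      using tr[OF g g] P[OF g] by (auto simp: P_beta_iff algebra_simps)
    moreover from this have "g$2$2 = 1" using eq_1_of_sum_prod by blast
    ultimately show "g \<in> uni I_beta"
      using \<open>g$3$2 = 0\<close> \<open>g$2$3 = 0\<close> zero by (auto simp: uni_iff)
  qed
qed auto

text \<open>Nilpotency kills the diagonal of a lower triangular matrix. Conversely a strictly lower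
  triangular \<open>3 \<times> 3\<close> matrix has cube \<open>0\<close>, so its \<open>p\<close>-th power vanishes for \<open>p \<ge> 3\<close>.\<close>

lemma N1_lie_Borel:
  assumes "p \<ge> 3"
  shows "N1 p (lie (Borel :: 'k::alg_closed_field mat3 set)) = low I_B"
proof
  show "N1 p (lie (Borel :: 'k mat3 set)) \<subseteq> low I_B"
  proof
    fix x :: "'k mat3" assume "x \<in> N1 p (lie Borel)"
    then have x: "x \<in> lie Borel" "matpow x p = 0" by (auto simp: N1_def)
    have "x$1$2 = 0" "x$1$3 = 0" "x$2$3 = 0"
      by (rule lie_entry_0[OF x(1)], simp add: Borel_iff mat1_nth index_neq)+
    with nilpotent_lower_diag[OF x(2)] show "x \<in> low I_B" by (simp add: low_iff)
  qed
  have "uni I_B \<subseteq> (Borel :: 'k mat3 set)" by (auto simp: uni_iff Borel_iff)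
  then have "low I_B \<subseteq> lie (Borel :: 'k mat3 set)" using lie_mono lie_uni by metis
  then show "low I_B \<subseteq> N1 p (lie (Borel :: 'k mat3 set))"
    unfolding N1_def using matpow_low[OF _ assms] by auto
qed

lemma N1_lie_SL3:
  assumes "p \<ge> 3"
  shows "low I_B \<subseteq> N1 p (lie (SL3 :: 'k::alg_closed_field mat3 set))"
proof -
  have "low I_B \<subseteq> lie (SL3 :: 'k mat3 set)" using lie_mono[OF uni_subset_SL3] lie_uni
    by (metis order_refl)
  then show ?thesis
    unfolding N1_def using matpow_low[OF _ assms] by auto
qed

section \<open>Projective modules over truncated polynomial rings\<close>

lemma free_act_free_module: "v \<in> free_module p n \<Longrightarrow> free_act p v \<in> free_module p n"
  by (auto simp: free_module_def free_act_def)

lemma klinear_on_zero: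
  assumes "klinear_on M f" "(\<lambda>_. 0) \<in> M" shows "f (\<lambda>_. 0) = (\<lambda>_. 0)"
  using assms(1)[unfolded klinear_on_def, rule_format, OF assms(2) assms(2), of 0 0] by simp

text \<open>The obstruction to projectivity used throughout: in a free module over \<open>k[x]/(x^p)\<close> the kernel
  of \<open>x\<close> is the image of \<open>x^(p-1)\<close>, and this passes to direct summands.\<close>

lemma projective_kernel:
  fixes M :: "('a \<Rightarrow> 'k::field) set"
  assumes proj: "projective p M X" and "p > 0"
    and zero: "(\<lambda>_. 0) \<in> M" and m: "m \<in> M" "X m = (\<lambda>_. 0)"
  shows "\<exists>h\<in>M. m = (X ^^ (p - 1)) h"
proof -
  obtain n \<iota> \<pi> where \<iota>: "\<iota> ` M \<subseteq> free_module p n" and \<pi>: "\<pi> ` free_module p n \<subseteq> M"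
    and lin: "klinear_on M \<iota>" and \<iota>X: "\<forall>m\<in>M. \<iota> (X m) = free_act p (\<iota> m)"
    and \<pi>X: "\<forall>v\<in>free_module p n. \<pi> (free_act p v) = X (\<pi> v)" and \<pi>\<iota>: "\<forall>m\<in>M. \<pi> (\<iota> m) = m"
    using proj unfolding projective_def by blast
  define v :: "nat \<times> nat \<Rightarrow> 'k" where "v = (\<lambda>(i, j). if j = 0 then \<iota> m (i, p - 1) else 0)"
  have im: "\<iota> m \<in> free_module p n" using \<iota> m by auto
  then have v: "v \<in> free_module p n"
    using \<open>p > 0\<close> by (auto simp: v_def free_module_def)
  have pow: "(free_act p ^^ k) v \<in> free_module p n \<and> \<pi> ((free_act p ^^ k) v) = (X ^^ k) (\<pi> v)" for k
    by (induction k) (use v \<pi>X free_act_free_module in auto)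
  have ker: "free_act p (\<iota> m) = (\<lambda>_. 0)"
    using \<iota>X[rule_format, OF m(1)] unfolding m(2) klinear_on_zero[OF lin zero] by simp
  have small: "\<iota> m (i, j) = 0" if "j < p - 1" for i j
  proof -
    have "Suc j < p" using that by simp
    then show ?thesis using fun_cong[OF ker, of "(i, Suc j)"] by (simp add: free_act_def)
  qed
  have "(free_act p ^^ k) v = (\<lambda>(i, j). if j = k \<and> k < p then \<iota> m (i, p - 1) else 0)" for k
    by (induction k) (use \<open>p > 0\<close> in \<open>auto simp: v_def free_act_def fun_eq_iff\<close>)
  from this[of "p - 1"] have "(free_act p ^^ (p - 1)) v = \<iota> m"
    using \<open>p > 0\<close> small im by (auto simp: fun_eq_iff free_module_def) (metis Suc_pred less_SucE)
  then have "m = (X ^^ (p - 1)) (\<pi> v)"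
    using pow[of "p - 1"] \<pi>\<iota> m by simp
  then show ?thesis using \<pi> v by auto
qed

text \<open>A free module is a summand of itself: \<open>\<iota>\<close> is the inverse of \<open>\<pi>\<close>, and the inverse of a linear
  equivariant bijection is again linear and equivariant.\<close>

lemma projective_if_free:
  fixes M :: "('a \<Rightarrow> 'k::field) set"
  assumes bij: "bij_betw \<pi> (free_module p n) M" and lin: "klinear_on (free_module p n) \<pi>"
    and \<pi>X: "\<And>v. v \<in> free_module p n \<Longrightarrow> \<pi> (free_act p v) = X (\<pi> v)"
  shows "projective p M X"
proof -
  define \<iota> where "\<iota> = inv_into (free_module p n) \<pi>"
  have \<iota>: "\<iota> m \<in> free_module p n" "\<pi> (\<iota> m) = m" if "m \<in> M" for m
    using that bij unfolding \<iota>_def bij_betw_def by (auto intro: inv_into_into f_inv_into_f)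
  have inv: "\<iota> (\<pi> v) = v" if "v \<in> free_module p n" for v
    using that bij unfolding \<iota>_def bij_betw_def by auto
  have comb: "(\<lambda>i. a * u i + b * v i) \<in> free_module p n"
    if "u \<in> free_module p n" "v \<in> free_module p n" for a b and u v :: "nat \<times> nat \<Rightarrow> 'k"
    using that by (auto simp: free_module_def)
  have "klinear_on M \<iota>"
    unfolding klinear_on_def
  proof (intro ballI allI)
    fix u v a b assume uv: "u \<in> M" "v \<in> M"
    have "\<pi> (\<lambda>i. a * \<iota> u i + b * \<iota> v i) = (\<lambda>i. a * u i + b * v i)"
      using lin \<iota> uv unfolding klinear_on_def by auto
    then show "\<iota> (\<lambda>i. a * u i + b * v i) = (\<lambda>j. a * \<iota> u j + b * \<iota> v j)"
      using inv[OF comb[OF \<iota>(1)[OF uv(1)] \<iota>(1)[OF uv(2)], of a b]] by simp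
  qed
  moreover have "\<iota> (X m) = free_act p (\<iota> m)" if "m \<in> M" for m
    using \<pi>X[OF \<iota>(1)[OF that]] inv[OF free_act_free_module[OF \<iota>(1)[OF that]]] \<iota>(2)[OF that] by simp
  ultimately show ?thesis
    unfolding projective_def
    by (intro exI[of _ n] exI[of _ \<iota>] exI[of _ \<pi>]) (use \<iota> \<pi>X lin bij in \<open>auto simp: bij_betw_def\<close>)
qed

definition lincomb :: "nat \<Rightarrow> (nat \<Rightarrow> 'b \<Rightarrow> 'k::field) \<Rightarrow> (nat \<Rightarrow> 'k) \<Rightarrow> 'b \<Rightarrow> 'k" where
  "lincomb l e c = (\<lambda>g. \<Sum>i\<le>l. c i * e i g)"

text \<open>Coefficients of the image of \<open>\<Sum> c\<^sub>i e\<^sub>i\<close> under \<open>e\<^sub>i \<mapsto> - a (l - i) e\<^sub>i\<^sub>+\<^sub>1\<close>. This is a root vector of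
  \<open>sl2\<close> acting on the binary forms of degree \<open>l\<close>. In the coefficient of \<open>e\<^sub>j\<close> the factor is \<open>l - (j - 1)\<close>,
  written \<open>Suc l - j\<close>.\<close>

definition weight_shift :: "'k::field \<Rightarrow> nat \<Rightarrow> (nat \<Rightarrow> 'k) \<Rightarrow> nat \<Rightarrow> 'k" where
  "weight_shift a l c j = (if j = 0 then 0 else - (a * of_nat (Suc l - j)) * c (j - 1))"

lemma lincomb_linear:
  "lincomb l e (\<lambda>i. a * c i + b * d i) = (\<lambda>g. a * lincomb l e c g + b * lincomb l e d g)"
  by (simp add: lincomb_def fun_eq_iff sum_distrib_left sum.distrib algebra_simps)

lemma lincomb_cong: "(\<And>i. i \<le> l \<Longrightarrow> c i = d i) \<Longrightarrow> lincomb l e c = lincomb l e d"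
  by (simp add: lincomb_def)

text \<open>The arithmetic behind the theorem. If \<open>a = 0\<close>, the operator vanishes and \<open>e\<^sub>0\<close> is a kernel vector
  that is not an image. If \<open>a \<noteq> 0\<close>, it annihilates \<open>e\<^sub>i\<close> exactly where \<open>p\<close> divides \<open>l - i\<close>, so the string
  \<open>e\<^sub>0, ..., e\<^sub>l\<close> breaks, counted from the end, into pieces of length \<open>p\<close>. If \<open>p\<close> divides \<open>l + 1\<close>, all
  pieces are full and each is a free module of rank one. Otherwise the first piece is shorter than
  \<open>p\<close>, and its last vector lies in the kernel but is not a \<open>(p-1)\<close>-st image.\<close>

lemma projective_string_iff:
  fixes e :: "nat \<Rightarrow> 'b \<Rightarrow> 'k::field"
  assumes "CHAR('k) = p" and "p \<ge> 2"
    and indep: "\<And>c. lincomb l e c = (\<lambda>_. 0) \<Longrightarrow> \<forall>i\<le>l. c i = 0"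
    and X: "\<And>c. X (lincomb l e c) = lincomb l e (weight_shift a l c)"
  shows "projective p (range (lincomb l e)) X \<longleftrightarrow> a \<noteq> 0 \<and> p dvd Suc l"
proof -
  have inj: "\<forall>i\<le>l. c i = d i" if "lincomb l e c = lincomb l e d" for c d
    using indep[of "\<lambda>i. 1 * c i + - 1 * d i"] that unfolding lincomb_linear by simp
  have zero: "lincomb l e (\<lambda>_. 0) = (\<lambda>_. 0)" by (simp add: lincomb_def)
  show ?thesis
  proof (cases "a \<noteq> 0 \<and> p dvd Suc l")
    case False
    \<comment> \<open>a vector \<open>e\<^sub>j\<close> of the kernel that sits too early in the string to be a \<open>(p-1)\<close>-st image\<close>
    have "\<exists>j. j \<le> l \<and> j < p - 1 \<and> a * of_nat (l - j) = 0"
    proof (cases "a = 0")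
      case True
      then show ?thesis using assms(2) by (intro exI[of _ 0]) auto
    next
      case False
      then have ndvd: "\<not> p dvd Suc l" using \<open>\<not> (a \<noteq> 0 \<and> p dvd Suc l)\<close> by auto
      define r where "r = Suc l mod p"
      have r: "0 < r" "r < p" "r \<le> Suc l"
        using ndvd assms(2) by (auto simp: r_def dvd_eq_mod_eq_0 intro: mod_less_eq_dividend)
      have "p dvd Suc l - r" by (simp add: r_def)
      moreover have "Suc l - r = l - (r - 1)" using r by simp
      ultimately have "of_nat (l - (r - 1)) = (0 :: 'k)"
        using of_nat_eq_0_iff_char_dvd assms(1) by metis
      then show ?thesis using r by (intro exI[of _ "r - 1"]) auto
    qed
    then obtain j where j: "j \<le> l" "j < p - 1" "a * of_nat (l - j) = 0" by blast
    define \<delta> where "\<delta> = (\<lambda>i. if i = j then 1 else 0 :: 'k)"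
    have "weight_shift a l \<delta> i = 0" for i
      using j(3) by (auto simp: weight_shift_def \<delta>_def)
    then have "lincomb l e (weight_shift a l \<delta>) = (\<lambda>_. 0)"
      by (simp add: lincomb_def)
    then have ker: "X (lincomb l e \<delta>) = (\<lambda>_. 0)"
      by (simp add: X)
    have "\<not> projective p (range (lincomb l e)) X"
    proof
      assume "projective p (range (lincomb l e)) X"
      moreover have "(\<lambda>_. 0) \<in> range (lincomb l e)"
        using zero by (metis rangeI)
      ultimately have "\<exists>h\<in>range (lincomb l e). lincomb l e \<delta> = (X ^^ (p - 1)) h"
        using assms(2) ker by (intro projective_kernel) auto
      then obtain c where c: "lincomb l e \<delta> = (X ^^ (p - 1)) (lincomb l e c)"
        by blast
      have "(X ^^ k) (lincomb l e c) = lincomb l e ((weight_shift a l ^^ k) c)" for k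
        by (induction k) (simp_all add: X)
      then have "\<delta> j = (weight_shift a l ^^ (p - 1)) c j"
        using inj j(1) c by simp
      moreover have "\<forall>i<k. (weight_shift a l ^^ k) c i = 0" for k
        by (induction k) (auto simp: weight_shift_def)
      ultimately show False using j(2) by (simp add: \<delta>_def)
    qed
    then show ?thesis using False by blast
  next
    case True
    then obtain m where m: "Suc l = p * m" by (auto elim: dvdE)
    have p: "prime p" using assms(1,2) prime_CHAR_semidom[where ?'a = 'k] by auto
    \<comment> \<open>\<open>d j * e (p i + j)\<close> is the image of \<open>e (p i)\<close> under the \<open>j\<close>-th power of the operator, since \<open>l + 1 = 0\<close> in the field\<close>
    define d where "d = (\<lambda>j. a ^ j * of_nat (fact j))"
    have d: "d j \<noteq> 0" if "j < p" for j
      using True that prime_dvd_fact_iff[OF p, of j] of_nat_eq_0_iff_char_dvd[where ?'a = 'k, of "fact j"]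
      by (simp add: d_def assms(1))
    have idx: "i \<le> l \<longleftrightarrow> i div p < m" for i
      using m assms(2) by (metis less_Suc_eq_le less_mult_imp_div_less mult.commute div_less_iff_less_mult not_less not_numeral_le_zero gr0I)
    define \<pi> where "\<pi> = (\<lambda>v. lincomb l e (\<lambda>i. d (i mod p) * v (i div p, i mod p)))"
    have "projective p (range (lincomb l e)) X"
    proof (rule projective_if_free)
      show "klinear_on (free_module p m) \<pi>"
        unfolding klinear_on_def \<pi>_def
        by (simp add: lincomb_linear[symmetric] algebra_simps)
      show "bij_betw \<pi> (free_module p m) (range (lincomb l e))"
        unfolding bij_betw_def
      proof
        show "inj_on \<pi> (free_module p m)"
        proof (rule inj_onI)
          fix v w assume vw: "v \<in> free_module p m" "w \<in> free_module p m" "\<pi> v = \<pi> w"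
          have "v (i, j) = w (i, j)" for i j
          proof (cases "i < m \<and> j < p")
            case True
            then have "(p * i + j) div p = i" "(p * i + j) mod p = j" by auto
            moreover from this True have "p * i + j \<le> l" by (simp add: idx)
            ultimately show ?thesis
              using inj[OF vw(3)[unfolded \<pi>_def]] d True by (metis mult_left_cancel)
          qed (use vw in \<open>auto simp: free_module_def\<close>)
          then show "v = w" by auto
        qed
        show "\<pi> ` free_module p m = range (lincomb l e)"
        proof
          show "range (lincomb l e) \<subseteq> \<pi> ` free_module p m"
          proof safe
            fix c
            define v where "v = (\<lambda>(i, j). if i < m \<and> j < p then c (p * i + j) / d j else 0)"
            have "v \<in> free_module p m" by (auto simp: v_def free_module_def)
            moreover have "lincomb l e c = \<pi> v"
              unfolding \<pi>_def v_def using assms(2) d by (intro lincomb_cong) (simp add: idx)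
            ultimately show "lincomb l e c \<in> \<pi> ` free_module p m" by blast
          qed
        qed (auto simp: \<pi>_def)
      qed
      fix v :: "nat \<times> nat \<Rightarrow> 'k" assume v: "v \<in> free_module p m"
      show "\<pi> (free_act p v) = X (\<pi> v)"
        unfolding \<pi>_def X
      proof (rule lincomb_cong)
        fix i assume i: "i \<le> l"
        have "of_nat (Suc l) = (0 :: 'k)"
          using True assms(1) of_nat_eq_0_iff_char_dvd by blast
        then have l: "of_nat (Suc l - i) = - (of_nat i :: 'k)"
          using i by (subst of_nat_diff) auto
        have "of_nat (p * (i div p)) = (0 :: 'k)"
          using assms(1) of_nat_eq_0_iff_char_dvd dvd_triv_left by blast
        then have i_mod: "of_nat i = (of_nat (i mod p) :: 'k)"
          by (metis add_0 mult_div_mod_eq of_nat_add)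
        show "d (i mod p) * free_act p v (i div p, i mod p) =
            weight_shift a l (\<lambda>i. d (i mod p) * v (i div p, i mod p)) i"
        proof (cases "i mod p")
          case 0
          then show ?thesis by (simp add: free_act_def weight_shift_def l i_mod)
        next
          case (Suc j)
          have "i mod p < p" using assms(2) by simp
          then have "0 < i" "Suc j < p" using Suc by (cases i; simp)+
          then obtain i' where i': "i = Suc i'" by (cases i) auto
          have "i' mod p = j" "i' div p = i div p"
            using Suc i' by (auto simp: mod_Suc div_Suc split: if_splits)
          moreover have "of_nat (Suc l - i) = - (of_nat (Suc j) :: 'k)"
            using l i_mod Suc by simp
          moreover have "d (Suc j) = a * of_nat (Suc j) * d j"
            by (simp add: d_def algebra_simps)
          moreover have "i - 1 = i'" using i' by simp
          ultimately show ?thesis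
            using \<open>0 < i\<close> Suc \<open>Suc j < p\<close>
            by (simp add: free_act_def weight_shift_def del: of_nat_Suc)
        qed
      qed
    qed
    then show ?thesis using True by blast
  qed
qed

section \<open>Line bundles on a projective line\<close>

text \<open>For strictly lower triangular \<open>x\<close> the line \<open>1 - t x\<close> lies in the unipotent group, hence
  \<open>(1 - t x) g\<close> stays in \<open>Z\<close>. The derivative in direction \<open>- x g\<close> therefore depends on the values on \<open>Z\<close>
  only, and can be computed from \<open>f\<close> itself.\<close>

lemma lie_act_eqI:
  fixes Z :: "'k::alg_closed_field mat3 set"
  assumes stable: "\<And>h g. h \<in> uni I_B \<Longrightarrow> g \<in> Z \<Longrightarrow> h ** g \<in> Z"
    and x: "x \<in> low I_B" and f: "f \<in> regular Z" and g: "g \<in> Z"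
    and q: "\<And>t. f ((mat 1 - map_matrix ((*) t) x) ** g) = poly q t"
  shows "lie_act Z x f g = coeff q 1"
proof -
  have line: "g + map_matrix ((*) t) (- (x ** g)) = (mat 1 - map_matrix ((*) t) x) ** g" for t
    by (simp add: mat3_eq_iff mult3_nth mat1_nth scale_nth index_neq algebra_simps)
  have in_Z: "(mat 1 - map_matrix ((*) t) x) ** g \<in> Z" for t
    by (rule stable[OF _ g]) (use x in \<open>simp add: uni_iff low_iff mat1_nth scale_nth index_neq\<close>)
  have D: "dderiv F g (- (x ** g)) = coeff q 1" if "\<forall>z\<in>Z. F z = f z" for F
    by (rule dderiv_eqI) (use that in_Z q line in simp)
  obtain F where F: "F \<in> polyfun" "\<forall>z\<in>Z. F z = f z"
    using f by (auto simp: regular_def)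
  have "(THE c. \<forall>F\<in>polyfun. (\<forall>z\<in>Z. F z = f z) \<longrightarrow> dderiv F g (- (x ** g)) = c) = coeff q 1"
    by (rule the_equality) (use D F in blast)+
  then show ?thesis using g by (simp add: lie_act_def)
qed

lemma coeff_linear_1_power:
  fixes b m :: "'k::comm_ring_1"
  shows "coeff ([:b, m:] ^ n) 1 = of_nat n * m * b ^ (n - 1)"
proof (cases n)
  case (Suc k)
  then show ?thesis using coeff_linear_poly_power[of 1 n b m] by simp
qed simp

text \<open>A common description of the line bundles on the quotients of \<open>P_alpha\<close> and \<open>P_beta\<close> by the Borel
  subgroup, both of which are projective lines. \<open>A\<close> and \<open>B\<close> are the homogeneous coordinates, on which
  the Borel subgroup acts from the right by the character \<open>\<theta>\<close>; \<open>C\<close> is a nowhere vanishing function of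
  weight \<open>\<eta>\<close> that twists the bundle of degree \<open>l\<close>; \<open>v\<close> and \<open>w\<close> lift the two affine charts to \<open>Z\<close>; and
  \<open>a x\<close> is the component of \<open>x\<close> along the only root space of \<open>u\<close> that moves the projective line.\<close>

locale line_bundle =
  fixes Z :: "'k::alg_closed_field mat3 set" and lam :: "int \<times> int" and l :: nat
    and A B C \<theta> \<eta> a :: "'k mat3 \<Rightarrow> 'k" and v w :: "'k \<Rightarrow> 'k mat3"
  assumes left_stable: "\<And>h g. h \<in> uni I_B \<Longrightarrow> g \<in> Z \<Longrightarrow> h ** g \<in> Z"
    and polyfun_ABC: "A \<in> polyfun" "B \<in> polyfun" "C \<in> polyfun"
    and equivariant: "\<And>g b. g \<in> Z \<Longrightarrow> b \<in> Borel \<Longrightarrow>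
      g ** b \<in> Z \<and> A (g ** b) = \<theta> b * A g \<and> B (g ** b) = \<theta> b * B g \<and> C (g ** b) = \<eta> b * C g"
    and weight: "\<And>b. b \<in> Borel \<Longrightarrow> inverse (weight_char lam b) = \<theta> b ^ l * \<eta> b"
    and v: "\<And>y. v y \<in> Z" "\<And>y. A (v y) = y" "\<And>y. B (v y) = 1" "\<And>y. C (v y) = 1"
      "\<And>i j. is_poly (\<lambda>y. v y $ i $ j)"
    and w: "\<And>y. w y \<in> Z" "\<And>y. A (w y) = 1" "\<And>y. B (w y) = y" "\<And>y. C (w y) = 1"
      "\<And>i j. is_poly (\<lambda>y. w y $ i $ j)"
    and v_cover: "\<And>g. g \<in> Z \<Longrightarrow> B g \<noteq> 0 \<Longrightarrow> \<exists>y. \<exists>b\<in>Borel. g = v y ** b"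
    and w_cover: "\<And>g. g \<in> Z \<Longrightarrow> A g \<noteq> 0 \<Longrightarrow> \<exists>y. \<exists>b\<in>Borel. g = w y ** b"
    and nonzero: "\<And>g. g \<in> Z \<Longrightarrow> A g \<noteq> 0 \<or> B g \<noteq> 0"
    and act: "\<And>x g h t. x \<in> low I_B \<Longrightarrow> g \<in> Z \<Longrightarrow> h = (mat 1 - map_matrix ((*) t) x) ** g \<Longrightarrow>
      A h = A g \<and> B h = B g - t * a x * A g \<and> C h = C g"
begin

definition basis_section :: "nat \<Rightarrow> 'k mat3 \<Rightarrow> 'k" where
  "basis_section i g = (if g \<in> Z then A g ^ i * B g ^ (l - i) * C g else 0)"

lemma lincomb_regular: "lincomb l basis_section c \<in> regular Z"
proof -
  have "(\<lambda>g. \<Sum>i\<le>l. c i * (A g ^ i * B g ^ (l - i) * C g)) \<in> polyfun"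
    by (intro polyfun_sum polyfun.mult polyfun_power polyfun.const polyfun_ABC)
  moreover have "lincomb l basis_section c = (\<lambda>g. if g \<in> Z then \<Sum>i\<le>l. c i * (A g ^ i * B g ^ (l - i) * C g) else 0)"
    by (auto simp: lincomb_def basis_section_def)
  ultimately show ?thesis
    unfolding regular_def mem_Collect_eq by (intro exI conjI)
qed

lemma lincomb_section: "lincomb l basis_section c \<in> bundle_sections Z lam"
proof -
  have "lincomb l basis_section c (g ** b) = inverse (weight_char lam b) * lincomb l basis_section c g"
    if "g \<in> Z" "b \<in> Borel" for g b
  proof -
    have "basis_section i (g ** b) = \<theta> b ^ l * \<eta> b * basis_section i g" if "i \<le> l" for i
    proof -
      have "\<theta> b ^ l = \<theta> b ^ i * \<theta> b ^ (l - i)" using that by (simp flip: power_add)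
      then show ?thesis
        using equivariant[OF \<open>g \<in> Z\<close> \<open>b \<in> Borel\<close>] \<open>g \<in> Z\<close>
        by (simp add: basis_section_def power_mult_distrib algebra_simps)
    qed
    then show ?thesis
      by (simp add: lincomb_def weight[OF that(2)] sum_distrib_left algebra_simps)
  qed
  then show ?thesis
    using lincomb_regular by (auto simp: bundle_sections_def)
qed

text \<open>The computation of the sections of degree \<open>l\<close> on the projective line: a section is a
  polynomial \<open>\<phi>\<close> on the chart \<open>B \<noteq> 0\<close> and a polynomial \<open>\<psi>\<close> on the chart \<open>A \<noteq> 0\<close>, and
  \<open>\<psi>(y) = y\<^sup>l \<phi>(1/y)\<close> on the overlap forces \<open>deg \<phi> \<le> l\<close>.\<close>

lemma section_lincomb:
  assumes f: "f \<in> bundle_sections Z lam"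
  shows "\<exists>c. f = lincomb l basis_section c"
proof -
  obtain F where F: "F \<in> polyfun" "f = (\<lambda>g. if g \<in> Z then F g else 0)"
    using f unfolding bundle_sections_def regular_def by auto
  have equi: "f (g ** b) = \<theta> b ^ l * \<eta> b * f g" if "g \<in> Z" "b \<in> Borel" for g b
    using f that weight by (auto simp: bundle_sections_def)
  obtain \<phi> where \<phi>: "\<And>y. f (v y) = poly \<phi> y"
    using polyfun_is_poly[OF F(1) v(5)] v(1) unfolding is_poly_def F(2) by auto
  obtain \<psi> where \<psi>: "\<And>y. f (w y) = poly \<psi> y"
    using polyfun_is_poly[OF F(1) w(5)] w(1) unfolding is_poly_def F(2) by auto
  have on_v: "f g = B g ^ l * C g * poly \<phi> (A g / B g)" if "g \<in> Z" "B g \<noteq> 0" for g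
  proof -
    obtain y b where g: "b \<in> Borel" "g = v y ** b" using v_cover[OF \<open>g \<in> Z\<close> \<open>B g \<noteq> 0\<close>] by blast
    have "A g = \<theta> b * y" "B g = \<theta> b" "C g = \<eta> b"
      using equivariant[OF v(1) g(1), of y] v by (simp_all add: g(2))
    then show ?thesis using equi[OF v(1) g(1), of y] that by (simp add: g(2) \<phi>)
  qed
  have on_w: "f g = A g ^ l * C g * poly \<psi> (B g / A g)" if "g \<in> Z" "A g \<noteq> 0" for g
  proof -
    obtain y b where g: "b \<in> Borel" "g = w y ** b" using w_cover[OF \<open>g \<in> Z\<close> \<open>A g \<noteq> 0\<close>] by blast
    have "A g = \<theta> b" "B g = \<theta> b * y" "C g = \<eta> b"
      using equivariant[OF w(1) g(1), of y] w by (simp_all add: g(2))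
    then show ?thesis using equi[OF w(1) g(1), of y] that by (simp add: g(2) \<psi>)
  qed
  have glue: "poly \<psi> y = y ^ l * poly \<phi> (inverse y)" if "y \<noteq> 0" for y
    using on_v[OF w(1), of y] that w by (simp add: \<psi> divide_inverse)
  have "monom 1 (degree \<phi>) * \<psi> = monom 1 l * reflect_poly \<phi>"
  proof (rule poly_eqI_cofinite[of "{0}"])
    fix t :: 'k assume "t \<notin> {0}"
    then show "poly (monom 1 (degree \<phi>) * \<psi>) t = poly (monom 1 l * reflect_poly \<phi>) t"
      by (simp add: poly_monom glue poly_reflect_poly_nz)
  qed simp
  \<comment> \<open>if \<open>deg \<phi> > l\<close>, the left side below is \<open>0\<close> and the right side is the leading coefficient of \<open>\<phi>\<close>\<close>
  then have "coeff (monom 1 (degree \<phi>) * \<psi>) l = coeff (monom 1 l * reflect_poly \<phi>) l"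
    by simp
  then have deg: "degree \<phi> \<le> l"
    by (cases "\<phi> = 0") (auto simp: coeff_monom_mult not_less split: if_splits)
  have \<phi>_sum: "poly \<phi> y = (\<Sum>i\<le>l. coeff \<phi> i * y ^ i)" for y
    by (subst poly_as_sum_of_monoms'[OF deg, symmetric]) (simp add: poly_sum poly_monom)
  have "\<psi> = (\<Sum>i\<le>l. monom (coeff \<phi> i) (l - i))"
  proof (rule poly_eqI_cofinite[of "{0}"])
    fix t :: 'k assume "t \<notin> {0}"
    then show "poly \<psi> t = poly (\<Sum>i\<le>l. monom (coeff \<phi> i) (l - i)) t"
      by (auto simp: poly_sum poly_monom glue \<phi>_sum sum_distrib_left power_diff field_simps
          intro!: sum.cong)
  qed simp
  then have \<psi>_sum: "poly \<psi> y = (\<Sum>i\<le>l. coeff \<phi> i * y ^ (l - i))" for y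
    by (simp add: poly_sum poly_monom)
  have "f g = lincomb l basis_section (coeff \<phi>) g" for g
  proof (cases "g \<in> Z")
    case True
    show ?thesis
    proof (cases "A g = 0")
      case False
      have "A g ^ l * C g * (coeff \<phi> i * (B g / A g) ^ (l - i)) =
          coeff \<phi> i * (A g ^ i * B g ^ (l - i) * C g)" if "i \<le> l" for i
      proof -
        have "A g ^ l = A g ^ i * A g ^ (l - i)" using that by (simp flip: power_add)
        then show ?thesis using False by (simp add: power_divide)
      qed
      note summand = this
      have "f g = (\<Sum>i\<le>l. A g ^ l * C g * (coeff \<phi> i * (B g / A g) ^ (l - i)))"
        using on_w[OF True False] by (simp add: \<psi>_sum sum_distrib_left)
      also have "\<dots> = (\<Sum>i\<le>l. coeff \<phi> i * (A g ^ i * B g ^ (l - i) * C g))"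
        by (intro sum.cong refl summand) simp
      finally show ?thesis using True by (simp add: lincomb_def basis_section_def)
    next
      case zero: True
      then have "B g \<noteq> 0" using nonzero[OF True] by auto
      have "lincomb l basis_section (coeff \<phi>) g = (\<Sum>i\<le>l. if i = 0 then coeff \<phi> 0 * (B g ^ l * C g) else 0)"
        using zero True unfolding lincomb_def basis_section_def by (intro sum.cong) auto
      also have "\<dots> = f g"
        using on_v[OF True \<open>B g \<noteq> 0\<close>] zero by (simp add: poly_0_coeff_0)
      finally show ?thesis ..
    qed
  qed (simp add: F(2) lincomb_def basis_section_def)
  then show ?thesis by blast
qed

lemma bundle_sections_eq: "bundle_sections Z lam = range (lincomb l basis_section)"
  using section_lincomb lincomb_section by blast

lemma sec_independent:
  assumes "lincomb l basis_section c = (\<lambda>_. 0)"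
  shows "\<forall>i\<le>l. c i = 0"
proof -
  have "(\<Sum>i\<le>l. monom (c i) i) = 0"
  proof (rule poly_fun_eqI)
    fix y
    show "poly (\<Sum>i\<le>l. monom (c i) i) y = poly 0 y"
      using fun_cong[OF assms, of "v y"] by (simp add: lincomb_def basis_section_def v poly_sum poly_monom)
  qed
  then have zero: "coeff (\<Sum>i\<le>l. monom (c i) i) j = 0" for j by simp
  have "c j = 0" if "j \<le> l" for j
    using zero[of j] that by (simp add: coeff_sum)
  then show ?thesis by blast
qed

lemma lie_act_lincomb:
  assumes x: "x \<in> low I_B"
  shows "lie_act Z x (lincomb l basis_section c) = lincomb l basis_section (weight_shift (a x) l c)"
proof
  fix g
  show "lie_act Z x (lincomb l basis_section c) g = lincomb l basis_section (weight_shift (a x) l c) g"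
  proof (cases "g \<in> Z")
    case True
    define q where "q = (\<Sum>i\<le>l. smult (c i * A g ^ i * C g) ([:B g, - (a x * A g):] ^ (l - i)))"
    have "lincomb l basis_section c ((mat 1 - map_matrix ((*) t) x) ** g) = poly q t" for t
    proof -
      let ?h = "(mat 1 - map_matrix ((*) t) x) ** g"
      have "?h \<in> Z"
        by (rule left_stable[OF _ True]) (use x in \<open>simp add: uni_iff low_iff mat1_nth scale_nth index_neq\<close>)
      moreover have "A ?h = A g" "B ?h = B g - t * a x * A g" "C ?h = C g"
        using act[OF x True, of ?h t] by auto
      ultimately show ?thesis
        by (simp add: lincomb_def basis_section_def q_def poly_sum) (simp add: algebra_simps)
    qed
    then have "lie_act Z x (lincomb l basis_section c) g = coeff q 1"
      by (intro lie_act_eqI[OF left_stable x lincomb_regular True])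
    also have "\<dots> = (\<Sum>i\<le>l. c i * A g ^ i * C g *
        (of_nat (l - i) * (- (a x * A g)) * B g ^ (l - i - 1)))"
      unfolding q_def coeff_sum coeff_smult coeff_linear_1_power ..
    also have "\<dots> = (\<Sum>i<l. c i * A g ^ i * C g *
        (of_nat (l - i) * (- (a x * A g)) * B g ^ (l - i - 1)))"
      by (simp add: lessThan_Suc_atMost[symmetric])
    also have "\<dots> = (\<Sum>i<l. weight_shift (a x) l c (Suc i) * basis_section (Suc i) g)"
      by (rule sum.cong) (simp_all add: weight_shift_def basis_section_def True algebra_simps)
    also have "\<dots> = (\<Sum>i<Suc l. weight_shift (a x) l c i * basis_section i g)"
      by (subst sum.lessThan_Suc_shift) (simp add: weight_shift_def)
    finally show ?thesis by (simp add: lincomb_def lessThan_Suc_atMost)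
  qed (simp add: lie_act_def lincomb_def basis_section_def)
qed

lemma projective_iff:
  assumes "CHAR('k) = p" "p \<ge> 2" "x \<in> low I_B"
  shows "projective p (bundle_sections Z lam) (lie_act Z x) \<longleftrightarrow> a x \<noteq> 0 \<and> p dvd Suc l"
  unfolding bundle_sections_eq
  by (rule projective_string_iff[OF assms(1,2) sec_independent])
    (use lie_act_lincomb[OF assms(3)] in auto)

end

section \<open>The line bundles over the small Schubert varieties\<close>

lemma zclosed_parabolic:
  "zclosed (Borel :: 'k::field mat3 set)" "zclosed (P_alpha :: 'k mat3 set)"
  "zclosed (P_beta :: 'k mat3 set)" "zclosed (SL3 :: 'k mat3 set)"
proof -
  have *: "zclosed {g :: 'k mat3. g $ i $ j = c}" for i j c
    by (intro zclosed_eq polyfun.coord)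
  have SL3: "zclosed (SL3 :: 'k mat3 set)" unfolding SL3_def by (intro zclosed_eq polyfun_det)
  have "Borel = (SL3 :: 'k mat3 set) \<inter> {g. g$1$2 = 0} \<inter> {g. g$1$3 = 0} \<inter> {g. g$2$3 = 0}" by (auto simp: Borel_def)
  then show "zclosed (Borel :: 'k mat3 set)" by (elim ssubst) (intro zclosed_Int SL3 *)
  have "P_alpha = (SL3 :: 'k mat3 set) \<inter> {g. g$1$3 = 0} \<inter> {g. g$2$3 = 0}" by (auto simp: P_alpha_def)
  then show "zclosed (P_alpha :: 'k mat3 set)" by (elim ssubst) (intro zclosed_Int SL3 *)
  have "P_beta = (SL3 :: 'k mat3 set) \<inter> {g. g$1$2 = 0} \<inter> {g. g$1$3 = 0}" by (auto simp: P_beta_def)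
  then show "zclosed (P_beta :: 'k mat3 set)" by (elim ssubst) (intro zclosed_Int SL3 *)
  show "zclosed (SL3 :: 'k mat3 set)" by (rule SL3)
qed

lemma parabolic_mult:
  "g \<in> Borel \<Longrightarrow> h \<in> Borel \<Longrightarrow> g ** h \<in> Borel"
  "g \<in> P_alpha \<Longrightarrow> h \<in> P_alpha \<Longrightarrow> g ** h \<in> P_alpha"
  "g \<in> P_beta \<Longrightarrow> h \<in> P_beta \<Longrightarrow> g ** h \<in> P_beta"
  by (auto simp: Borel_def P_alpha_def P_beta_def mult3_nth intro: SL3_mult)

lemma Borel_between: "Borel \<subseteq> P_alpha" "Borel \<subseteq> P_beta" "uni I_B \<subseteq> Borel"
  by (auto simp: Borel_def P_alpha_def P_beta_def uni_iff SL3_def det_3)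

lemma weight_char_inverse:
  fixes b :: "'k::field mat3"
  assumes "b \<in> Borel" "l1 \<ge> 0" "l2 \<ge> 0"
  shows "inverse (weight_char (l1, l2) b) = (b$2$2 * b$3$3) ^ nat l1 * b$3$3 ^ nat l2"
proof -
  have b: "b$1$1 * b$2$2 * b$3$3 = 1" using assms(1) by (simp add: Borel_iff)
  have "inverse (b$1$1) = b$2$2 * b$3$3" "inverse (b$1$1 * b$2$2) = b$3$3"
    by (rule inverse_unique, use b in \<open>simp add: mult.assoc\<close>)+
  moreover have "weight_char (l1, l2) b = b$1$1 ^ nat l1 * (b$1$1 * b$2$2) ^ nat l2"
    using assms(2,3) by (simp add: weight_char_def power_int_def)
  moreover have "inverse (s ^ m * t ^ n) = inverse s ^ m * inverse t ^ n" for s t :: 'k and m n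
    by (simp add: power_inverse)
  ultimately show ?thesis by (simp only:)
qed

text \<open>Curves in the two parabolics that trace out the two standard affine charts of the projective
  lines obtained from them as quotients by the Borel subgroup.\<close>

definition v_alpha :: "'k::field \<Rightarrow> 'k mat3" where "v_alpha y = M3 1 y 0 0 1 0 0 0 1"
definition w_alpha :: "'k::field \<Rightarrow> 'k mat3" where "w_alpha y = M3 0 1 0 (-1) y 0 0 0 1"
definition v_beta :: "'k::field \<Rightarrow> 'k mat3" where "v_beta y = M3 1 0 0 0 1 y 0 0 1"
definition w_beta :: "'k::field \<Rightarrow> 'k mat3" where "w_beta y = M3 1 0 0 0 0 1 0 (-1) y"

lemma is_poly_M3:
  assumes "is_poly a" "is_poly b" "is_poly c" "is_poly d" "is_poly e" "is_poly f"
    "is_poly g" "is_poly h" "is_poly k"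
  shows "is_poly (\<lambda>t. M3 (a t) (b t) (c t) (d t) (e t) (f t) (g t) (h t) (k t) $ i $ j)"
  using assms exhaust_3[of i] exhaust_3[of j] by auto

lemma w_cover_alpha:
  fixes g :: "'k::field mat3"
  assumes "g \<in> P_alpha" "g$1$2 \<noteq> 0"
  shows "\<exists>y. \<exists>b\<in>Borel. g = w_alpha y ** b"
proof (intro exI bexI)
  let ?y = "g$2$2 / g$1$2" and ?b = "M3 (g$2$2 / g$1$2) (-1) 0 1 0 0 0 0 1 ** g"
  show "g = w_alpha ?y ** ?b"
    unfolding matrix_mul_assoc by (simp add: w_alpha_def mat3_eq_iff mult3_nth)
  have "?b \<in> P_alpha"
    by (rule parabolic_mult(2)[OF _ assms(1)]) (simp add: P_alpha_iff)
  then show "?b \<in> Borel"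
    using assms by (simp add: P_alpha_def Borel_def mult3_nth)
qed

lemma w_cover_beta:
  fixes g :: "'k::field mat3"
  assumes "g \<in> P_beta" "g$2$3 \<noteq> 0"
  shows "\<exists>y. \<exists>b\<in>Borel. g = w_beta y ** b"
proof (intro exI bexI)
  let ?y = "g$3$3 / g$2$3" and ?b = "M3 1 0 0 0 (g$3$3 / g$2$3) (-1) 0 1 0 ** g"
  show "g = w_beta ?y ** ?b"
    unfolding matrix_mul_assoc by (simp add: w_beta_def mat3_eq_iff mult3_nth)
  have "?b \<in> P_beta"
    by (rule parabolic_mult(3)[OF _ assms(1)]) (simp add: P_beta_iff)
  then show "?b \<in> Borel"
    using assms by (simp add: P_beta_def Borel_def mult3_nth)
qed

lemma line_bundle_alpha:
  fixes l1 l2 :: int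
  assumes "l1 \<ge> 0" "l2 \<ge> 0"
  shows "line_bundle (P_alpha :: 'k::alg_closed_field mat3 set) (l1, l2) (nat l1)
    (\<lambda>g. g$1$2) (\<lambda>g. g$2$2) (\<lambda>g. g$3$3 ^ nat (l1 + l2))
    (\<lambda>b. b$2$2) (\<lambda>b. b$3$3 ^ nat (l1 + l2)) (\<lambda>x. x$2$1) v_alpha w_alpha"
proof (unfold_locales, goal_cases)
  case 1
  then show ?case using Borel_between parabolic_mult(2) by blast
next
  case (5 g b)
  then show ?case
    using Borel_between parabolic_mult(2)[of g b]
    by (auto simp: mult3_nth P_alpha_iff Borel_iff power_mult_distrib)
next
  case (6 b)
  then show ?case using assms
    by (simp add: weight_char_inverse nat_add_distrib power_add power_mult_distrib)
next
  case (17 g)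
  let ?y = "g$1$2 / g$2$2" and ?b = "M3 1 (- (g$1$2 / g$2$2)) 0 0 1 0 0 0 1 ** g"
  have "g = v_alpha ?y ** ?b"
    unfolding matrix_mul_assoc by (simp add: v_alpha_def mat3_eq_iff mult3_nth)
  moreover have "?b \<in> P_alpha"
    by (rule parabolic_mult(2)[OF _ 17(1)]) (simp add: P_alpha_iff)
  then have "?b \<in> Borel"
    using 17 by (simp add: P_alpha_def Borel_def mult3_nth)
  ultimately show ?case by blast
next
  case 18
  then show ?case by (rule w_cover_alpha)
next
  case (20 x g h t)
  then show ?case by (simp add: low_iff P_alpha_iff mult3_nth mat1_nth scale_nth index_neq)
qed (auto simp: v_alpha_def w_alpha_def P_alpha_iff
    intro!: polyfun_intros is_poly_M3 is_poly_intros)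

lemma line_bundle_beta:
  fixes l1 l2 :: int
  assumes "l1 \<ge> 0" "l2 \<ge> 0"
  shows "line_bundle (P_beta :: 'k::alg_closed_field mat3 set) (l1, l2) (nat l2)
    (\<lambda>g. g$2$3) (\<lambda>g. g$3$3) (\<lambda>g. (g$2$2 * g$3$3 - g$2$3 * g$3$2) ^ nat l1)
    (\<lambda>b. b$3$3) (\<lambda>b. (b$2$2 * b$3$3) ^ nat l1) (\<lambda>x. x$3$2) v_beta w_beta"
proof (unfold_locales, goal_cases)
  case 1
  then show ?case using Borel_between parabolic_mult(3) by blast
next
  case (5 g b)
  then have "(g ** b)$2$2 * (g ** b)$3$3 - (g ** b)$2$3 * (g ** b)$3$2
      = b$2$2 * b$3$3 * (g$2$2 * g$3$3 - g$2$3 * g$3$2)"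
    by (simp add: mult3_nth P_beta_iff Borel_iff algebra_simps)
  then show ?case
    using 5 Borel_between parabolic_mult(3)[of g b]
    by (auto simp: mult3_nth P_beta_iff Borel_iff simp flip: power_mult_distrib)
next
  case (6 b)
  then show ?case using assms by (simp add: weight_char_inverse)
next
  case (17 g)
  let ?y = "g$2$3 / g$3$3" and ?b = "M3 1 0 0 0 1 (- (g$2$3 / g$3$3)) 0 0 1 ** g"
  have "g = v_beta ?y ** ?b"
    unfolding matrix_mul_assoc by (simp add: v_beta_def mat3_eq_iff mult3_nth)
  moreover have "?b \<in> P_beta"
    by (rule parabolic_mult(3)[OF _ 17(1)]) (simp add: P_beta_iff)
  then have "?b \<in> Borel"
    using 17 by (simp add: P_beta_def Borel_def mult3_nth)
  ultimately show ?case by blast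
next
  case 18
  then show ?case by (rule w_cover_beta)
next
  case (20 x g h t)
  then have "h$2$2 * h$3$3 - h$2$3 * h$3$2 = g$2$2 * g$3$3 - g$2$3 * g$3$2"
    by (simp add: low_iff P_beta_iff mult3_nth mat1_nth scale_nth index_neq algebra_simps)
  then show ?case using 20 by (simp add: low_iff P_beta_iff mult3_nth mat1_nth scale_nth index_neq)
qed (auto simp: v_beta_def w_beta_def P_beta_iff
    intro!: polyfun_intros is_poly_M3 is_poly_intros)

text \<open>Over a point the sections form the one-dimensional module spanned by the inverse character,
  which is constant on unipotent elements. It is the string of length one with zero action.\<close>

lemma not_projective_Borel:
  fixes x :: "'k::alg_closed_field mat3"
  assumes "CHAR('k) = p" "p \<ge> 2" "l1 \<ge> 0" "l2 \<ge> 0" "x \<in> low I_B"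
  shows "\<not> projective p (bundle_sections Borel (l1, l2)) (lie_act Borel x)"
proof -
  define C where "C = (\<lambda>g::'k mat3. (g$2$2 * g$3$3) ^ nat l1 * g$3$3 ^ nat l2)"
  define e where "e = (\<lambda>(_::nat) g. if g \<in> Borel then C g else 0)"
  have C: "C (g ** b) = C b * C g" if "g \<in> Borel" "b \<in> Borel" for g b
    using that by (simp add: C_def mult3_nth Borel_iff power_mult_distrib)
  have weight: "inverse (weight_char (l1, l2) b) = C b" if "b \<in> Borel" for b
    using that assms by (simp add: C_def weight_char_inverse)
  have poly: "(\<lambda>g. c * C g) \<in> polyfun" for c :: 'k
    unfolding C_def by (intro polyfun_intros)
  have lc: "lincomb 0 e c = (\<lambda>g. if g \<in> Borel then c 0 * C g else 0)" for c
    by (auto simp: lincomb_def e_def)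
  then have reg: "lincomb 0 e c \<in> regular Borel" for c
    unfolding regular_def mem_Collect_eq using poly[of "c 0"] by (intro exI conjI)
  have one: "(mat 1 :: 'k mat3) \<in> Borel" "C (mat 1) = 1"
    by (simp_all add: C_def Borel_iff mat1_nth index_neq)
  have "bundle_sections Borel (l1, l2) = range (lincomb 0 e)"
  proof
    show "bundle_sections Borel (l1, l2) \<subseteq> range (lincomb 0 e)"
    proof
      fix f :: "'k mat3 \<Rightarrow> 'k" assume f: "f \<in> bundle_sections Borel (l1, l2)"
      then have "f (mat 1 ** b) = inverse (weight_char (l1, l2) b) * f (mat 1)" if "b \<in> Borel" for b
        using one(1) that unfolding bundle_sections_def by blast
      then have "f b = C b * f (mat 1)" if "b \<in> Borel" for b
        using that weight[OF that] by simp
      moreover have "f g = 0" if "g \<notin> Borel" for g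
        using f that by (auto simp: bundle_sections_def regular_def)
      ultimately have "f g = lincomb 0 e (\<lambda>_. f (mat 1)) g" for g
        unfolding lc by (cases "g \<in> Borel") (simp_all only: if_True if_False mult.commute)
      then have "f = lincomb 0 e (\<lambda>_. f (mat 1))" ..
      then show "f \<in> range (lincomb 0 e)" by blast
    qed
    have "lincomb 0 e c (g ** b) = inverse (weight_char (l1, l2) b) * lincomb 0 e c g"
      if "g \<in> Borel" "b \<in> Borel" for c g b
      using parabolic_mult(1)[OF that] that by (simp add: lc C weight)
    then show "range (lincomb 0 e) \<subseteq> bundle_sections Borel (l1, l2)"
      using reg by (auto simp: bundle_sections_def)
  qed
  moreover have "lie_act Borel x (lincomb 0 e c) = lincomb 0 e (weight_shift 0 0 c)" for c
  proof
    fix g :: "'k mat3"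
    have "lie_act Borel x (lincomb 0 e c) g = 0"
    proof (cases "g \<in> Borel")
      case True
      let ?h = "\<lambda>t. mat 1 - map_matrix ((*) t) x"
      have h: "?h t \<in> uni I_B" for t
        using assms(5) by (simp add: uni_iff low_iff mat1_nth scale_nth index_neq)
      have "C (?h t) = 1" for t using h[of t] by (simp add: C_def uni_iff)
      then have "C (?h t ** g) = C g" for t
        using C[OF _ True, of "?h t"] h[of t] Borel_between(3) by auto
      then have "lincomb 0 e c (?h t ** g) = poly [:c 0 * C g:] t" for t
        using parabolic_mult(1)[OF _ True] h[of t] Borel_between(3) by (auto simp: lc)
      then have "lie_act Borel x (lincomb 0 e c) g = coeff [:c 0 * C g:] 1"
        using Borel_between(3) parabolic_mult(1)
        by (intro lie_act_eqI[OF _ assms(5) reg True]) auto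
      then show ?thesis by simp
    qed (simp add: lie_act_def)
    then show "lie_act Borel x (lincomb 0 e c) g = lincomb 0 e (weight_shift 0 0 c) g"
      by (simp add: lc weight_shift_def)
  qed
  moreover have "\<forall>i\<le>0. c i = 0" if "lincomb 0 e c = (\<lambda>_. 0)" for c
    using fun_cong[OF that, of "mat 1"] one by (simp add: lc)
  ultimately show ?thesis
    using projective_string_iff[OF assms(1,2), of 0 e "lie_act Borel x" 0] by simp
qed

section \<open>Schubert varieties\<close>

lemma schubert_eq_curves:
  fixes Z :: "'k::alg_closed_field mat3 set"
  assumes "zclosed Z" "Borel \<subseteq> Z" "s \<in> Z" "\<And>g h. g \<in> Z \<Longrightarrow> h \<in> Z \<Longrightarrow> g ** h \<in> Z"
    and "\<And>z. z \<in> Z \<Longrightarrow> \<exists>c r. (\<forall>i j. is_poly (\<lambda>t. c t $ i $ j)) \<and> c 0 = z \<and>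
      is_poly r \<and> (\<exists>t. r t \<noteq> 0) \<and> (\<forall>t. r t \<noteq> 0 \<longrightarrow> (\<exists>b\<in>Borel. \<exists>b'\<in>Borel. c t = b ** s ** b'))"
  shows "schubert s = Z"
  unfolding schubert_def
proof (rule zclosure_eqI_curves[OF assms(1)])
  show "{b ** s ** b' |b b'. b \<in> Borel \<and> b' \<in> Borel} \<subseteq> Z"
    using assms(2-4) by blast
  fix z assume "z \<in> Z"
  from assms(5)[OF this] show "\<exists>c r. (\<forall>i j. is_poly (\<lambda>t. c t $ i $ j)) \<and> c 0 = z \<and>
      is_poly r \<and> (\<exists>t. r t \<noteq> 0) \<and>
      (\<forall>t. r t \<noteq> 0 \<longrightarrow> c t \<in> {b ** s ** b' |b b'. b \<in> Borel \<and> b' \<in> Borel})"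
    by (elim ex_forward conj_forward) blast+
qed

lemma mat_1_Borel: "mat 1 \<in> Borel"
  by (simp add: Borel_iff mat1_nth index_neq)

lemma schubert_1: "schubert (mat 1) = (Borel :: 'k::alg_closed_field mat3 set)"
proof (rule schubert_eq_curves[OF zclosed_parabolic(1) order_refl mat_1_Borel parabolic_mult(1)])
  fix z :: "'k mat3" assume z: "z \<in> Borel"
  show "\<exists>c r. (\<forall>i j. is_poly (\<lambda>t. c t $ i $ j)) \<and> c 0 = z \<and>
      is_poly r \<and> (\<exists>t. r t \<noteq> 0) \<and> (\<forall>t. r t \<noteq> 0 \<longrightarrow> (\<exists>b\<in>Borel. \<exists>b'\<in>Borel. c t = b ** mat 1 ** b'))"
    by (intro exI[of _ "\<lambda>_. z"] exI[of _ "\<lambda>_. 1"] conjI allI impI is_poly_intros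
        bexI[of _ z] bexI[of _ "mat 1"] mat_1_Borel z) auto
qed

lemma is_poly_mult_mat:
  fixes c :: "'k::field \<Rightarrow> 'k mat3" and z :: "'k mat3"
  assumes "\<And>i j. is_poly (\<lambda>t. c t $ i $ j)"
  shows "is_poly (\<lambda>t. (c t ** z) $ i $ j)"
  unfolding mult3_nth by (intro is_poly_intros assms)

text \<open>Off the locus \<open>z$1$2 = 0\<close> a point lies in the open double coset, by \<open>w_cover_alpha\<close>. The curve
  \<open>v_alpha t ** z\<close> leaves this locus, because on it \<open>z$2$2\<close> does not vanish.\<close>

lemma schubert_alpha: "schubert s_alpha = (P_alpha :: 'k::alg_closed_field mat3 set)"
proof (rule schubert_eq_curves[OF zclosed_parabolic(2) Borel_between(1) _ parabolic_mult(2)])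
  show "(s_alpha :: 'k mat3) \<in> P_alpha"
    by (simp add: s_alpha_def P_alpha_iff)
  fix z :: "'k mat3" assume z: "z \<in> P_alpha"
  let ?c = "\<lambda>t. v_alpha t ** z" and ?r = "\<lambda>t. z$1$2 + t * z$2$2"
  have "z$1$2 \<noteq> 0 \<or> z$2$2 \<noteq> 0" using z by (auto simp: P_alpha_iff)
  then have "?r 0 \<noteq> 0 \<or> ?r 1 \<noteq> 0" by auto
  then have nz: "\<exists>t. ?r t \<noteq> 0" by blast
  have cell: "\<exists>b\<in>Borel. \<exists>b'\<in>Borel. ?c t = b ** s_alpha ** b'" if "?r t \<noteq> 0" for t
  proof -
    have "v_alpha t \<in> P_alpha" by (simp add: v_alpha_def P_alpha_iff)
    then have "?c t \<in> P_alpha" using z by (rule parabolic_mult(2))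
    moreover have "?c t $ 1 $ 2 \<noteq> 0"
      using that by (simp add: v_alpha_def mult3_nth)
    ultimately obtain y b where b: "b \<in> Borel" "?c t = w_alpha y ** b" using w_cover_alpha by blast
    have "w_alpha y = M3 1 0 0 y 1 0 0 0 1 ** s_alpha"
      by (simp add: w_alpha_def s_alpha_def mat3_eq_iff mult3_nth)
    moreover have "M3 1 0 0 y 1 0 0 0 1 \<in> Borel" by (simp add: Borel_iff)
    ultimately show ?thesis using b by metis
  qed
  have "?c 0 = z" by (simp add: v_alpha_def mat3_eq_iff mult3_nth)
  moreover have "is_poly (\<lambda>t. ?c t $ i $ j)" for i j
    unfolding v_alpha_def by (intro is_poly_mult_mat is_poly_M3 is_poly_intros)
  moreover have "is_poly ?r" by (intro is_poly_intros)
  ultimately show "\<exists>c r. (\<forall>i j. is_poly (\<lambda>t. c t $ i $ j)) \<and> c 0 = z \<and> is_poly r \<and> (\<exists>t. r t \<noteq> 0) \<and>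
      (\<forall>t. r t \<noteq> 0 \<longrightarrow> (\<exists>b\<in>Borel. \<exists>b'\<in>Borel. c t = b ** s_alpha ** b'))"
    using nz cell by (intro exI[of _ ?c] exI[of _ ?r]) blast
qed

lemma schubert_beta: "schubert s_beta = (P_beta :: 'k::alg_closed_field mat3 set)"
proof (rule schubert_eq_curves[OF zclosed_parabolic(3) Borel_between(2) _ parabolic_mult(3)])
  show "(s_beta :: 'k mat3) \<in> P_beta"
    by (simp add: s_beta_def P_beta_iff)
  fix z :: "'k mat3" assume z: "z \<in> P_beta"
  let ?c = "\<lambda>t. v_beta t ** z" and ?r = "\<lambda>t. z$2$3 + t * z$3$3"
  have "z$2$3 \<noteq> 0 \<or> z$3$3 \<noteq> 0" using z by (auto simp: P_beta_iff)
  then have "?r 0 \<noteq> 0 \<or> ?r 1 \<noteq> 0" by auto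
  then have nz: "\<exists>t. ?r t \<noteq> 0" by blast
  have cell: "\<exists>b\<in>Borel. \<exists>b'\<in>Borel. ?c t = b ** s_beta ** b'" if "?r t \<noteq> 0" for t
  proof -
    have "v_beta t \<in> P_beta" by (simp add: v_beta_def P_beta_iff)
    then have "?c t \<in> P_beta" using z by (rule parabolic_mult(3))
    moreover have "?c t $ 2 $ 3 \<noteq> 0"
      using that by (simp add: v_beta_def mult3_nth)
    ultimately obtain y b where b: "b \<in> Borel" "?c t = w_beta y ** b" using w_cover_beta by blast
    have "w_beta y = M3 1 0 0 0 1 0 0 y 1 ** s_beta"
      by (simp add: w_beta_def s_beta_def mat3_eq_iff mult3_nth)
    moreover have "M3 1 0 0 0 1 0 0 y 1 \<in> Borel" by (simp add: Borel_iff)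
    ultimately show ?thesis using b by metis
  qed
  have "?c 0 = z" by (simp add: v_beta_def mat3_eq_iff mult3_nth)
  moreover have "is_poly (\<lambda>t. ?c t $ i $ j)" for i j
    unfolding v_beta_def by (intro is_poly_mult_mat is_poly_M3 is_poly_intros)
  moreover have "is_poly ?r" by (intro is_poly_intros)
  ultimately show "\<exists>c r. (\<forall>i j. is_poly (\<lambda>t. c t $ i $ j)) \<and> c 0 = z \<and> is_poly r \<and> (\<exists>t. r t \<noteq> 0) \<and>
      (\<forall>t. r t \<noteq> 0 \<longrightarrow> (\<exists>b\<in>Borel. \<exists>b'\<in>Borel. c t = b ** s_beta ** b'))"
    using nz cell by (intro exI[of _ ?c] exI[of _ ?r]) blast
qed

lemma longest_element: "s_alpha ** s_beta ** s_alpha = (M3 0 0 1 0 (-1) 0 1 0 0 :: 'k::field mat3)"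
  by (simp add: s_alpha_def s_beta_def mat3_eq_iff mult3_nth)

text \<open>Gaussian elimination from the upper right corner. The factor \<open>c\<close> clears the entries that are
  zero in the product of \<open>w\<^sub>0\<close> and a lower triangular matrix. The linear system for its last row has
  the determinant \<open>- D\<close>, and that is where the minor is needed.\<close>

lemma big_cell:
  fixes g :: "'k::field mat3"
  assumes g: "g \<in> SL3" and nz: "g$1$3 \<noteq> 0" "g$1$2 * g$2$3 - g$1$3 * g$2$2 \<noteq> 0"
  shows "\<exists>b\<in>Borel. \<exists>b'\<in>Borel. g = b ** M3 0 0 1 0 (-1) 0 1 0 0 ** b'"
proof -
  define D where "D = g$1$2 * g$2$3 - g$1$3 * g$2$2"
  define c where "c = M3 1 0 0 (- (g$2$3 / g$1$3)) 1 0
    ((g$2$2 * g$3$3 - g$2$3 * g$3$2) / D) ((g$1$3 * g$3$2 - g$1$2 * g$3$3) / D) 1"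
  let ?w = "M3 0 0 1 0 (-1) 0 1 0 0 :: 'k mat3"
  have c: "c \<in> SL3" by (simp add: c_def SL3_def det_3)
  have "adj3 c \<in> Borel" by (simp add: c_def adj3_def Borel_iff)
  moreover have "?w ** (c ** g) \<in> Borel"
  proof -
    have "?w \<in> SL3" by (simp add: SL3_def det_3)
    then have "?w ** (c ** g) \<in> SL3" using c g by (intro SL3_mult)
    moreover have "(c ** g)$2$3 = 0" using nz by (simp add: c_def mult3_nth)
    moreover have "D * (c ** g)$3$2 = 0" "D * (c ** g)$3$3 = 0"
      using nz by (simp_all add: c_def mult3_nth distrib_left D_def[symmetric])
        (simp_all add: D_def algebra_simps)
    then have "(c ** g)$3$2 = 0" "(c ** g)$3$3 = 0" using nz by (auto simp: D_def)
    ultimately show ?thesis by (simp add: Borel_def mult3_nth[of ?w])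
  qed
  moreover have "g = adj3 c ** ?w ** (?w ** (c ** g))"
  proof -
    have "?w ** (?w ** (c ** g)) = c ** g"
      unfolding matrix_mul_assoc by (simp add: mat3_eq_iff mult3_nth)
    then have "adj3 c ** (?w ** (?w ** (c ** g))) = g"
      by (simp add: matrix_mul_assoc adj3_inverse[OF c])
    then show ?thesis by (simp add: matrix_mul_assoc)
  qed
  ultimately show ?thesis by blast
qed

text \<open>A general translate of \<open>z\<close> lies in the big cell. The exponents \<open>1, 3, 1\<close> of the translating
  curve make the nonzero coefficients of the two defining minors, as polynomials in \<open>t\<close>, the entries of
  the last column of \<open>z\<close>, respectively the minors of its last two columns up to sign. As \<open>det z \<noteq> 0\<close>,
  neither polynomial is zero.\<close>

lemma schubert_longest: "schubert (s_alpha ** s_beta ** s_alpha) = (SL3 :: 'k::alg_closed_field mat3 set)"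
  unfolding longest_element
proof (rule schubert_eq_curves[OF zclosed_parabolic(4) parabolic_subset_SL3(1) _ SL3_mult])
  let ?w = "M3 0 0 1 0 (-1) 0 1 0 0 :: 'k mat3"
  show "?w \<in> SL3" by (simp add: SL3_def det_3)
  fix z :: "'k mat3" assume z: "z \<in> SL3"
  define m where "m = (\<lambda>i j. z$i$2 * z$j$3 - z$i$3 * z$j$2)"
  let ?u = "\<lambda>t. M3 1 t (t ^ 3) 0 1 t 0 0 1"
  let ?c = "\<lambda>t. ?u t ** z"
  let ?q1 = "[:z$1$3, z$2$3, 0, z$3$3:]" and ?q2 = "[:m 1 2, m 1 3, m 2 3, - m 2 3:]"
  let ?r = "poly (?q1 * ?q2)"
  have r: "?r t = ?c t $1$3 * (?c t $1$2 * ?c t $2$3 - ?c t $1$3 * ?c t $2$2)" for t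
  proof -
    have "poly ?q1 t = ?c t $1$3"
      by (simp add: mult3_nth power3_eq_cube algebra_simps)
    moreover have "poly ?q2 t = ?c t $1$2 * ?c t $2$3 - ?c t $1$3 * ?c t $2$2"
      by (simp add: mult3_nth m_def power3_eq_cube algebra_simps)
    ultimately show ?thesis by (simp only: poly_mult)
  qed
  have det: "det z = z$1$1 * m 2 3 - z$2$1 * m 1 3 + z$3$1 * m 1 2"
    by (simp add: det_3 m_def algebra_simps)
  have "?q1 \<noteq> 0" "?q2 \<noteq> 0"
    using z det by (auto simp: SL3_def det_3)
  then have "?q1 * ?q2 \<noteq> 0" by (rule no_zero_divisors)
  then have nz: "\<exists>t. ?r t \<noteq> 0"
    using poly_fun_eqI[of "?q1 * ?q2" 0] by (metis poly_0)
  have cell: "\<exists>b\<in>Borel. \<exists>b'\<in>Borel. ?c t = b ** ?w ** b'" if "?r t \<noteq> 0" for t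
  proof (rule big_cell)
    have "?u t \<in> SL3" by (simp add: SL3_def det_3)
    then show "?c t \<in> SL3" using z by (rule SL3_mult)
  qed (use that r[of t] in auto)
  have "?c 0 = z" by (simp add: mat3_eq_iff mult3_nth)
  moreover have "is_poly (\<lambda>t. ?c t $ i $ j)" for i j
    by (intro is_poly_mult_mat is_poly_M3 is_poly_intros)
  moreover have "is_poly ?r" unfolding is_poly_def by blast
  ultimately show "\<exists>c r. (\<forall>i j. is_poly (\<lambda>t. c t $ i $ j)) \<and> c 0 = z \<and> is_poly r \<and> (\<exists>t. r t \<noteq> 0) \<and>
      (\<forall>t. r t \<noteq> 0 \<longrightarrow> (\<exists>b\<in>Borel. \<exists>b'\<in>Borel. c t = b ** ?w ** b'))"
    using nz cell by (intro exI[of _ ?c] exI[of _ ?r]) blast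
qed

section \<open>The support varieties\<close>

theorem mainTheorem11:
  fixes p :: nat and lam1 lam2 :: int
    and V_B :: "'k::alg_closed_field mat3 \<Rightarrow> 'k mat3 set"
    and u u_alpha u_beta :: "'k mat3 set"
  assumes "CHAR('k) = p" and "p \<ge> 3"
    and "dominant (lam1, lam2)"
  defines "V_B \<equiv> \<lambda>w. support_variety p Borel (schubert w) (lam1, lam2)"
    and "u \<equiv> lie (unipotent_radical Borel)"
    and "u_alpha \<equiv> lie (unipotent_radical P_alpha)"
    and "u_beta \<equiv> lie (unipotent_radical P_beta)"
  shows "V_B (mat 1) = u \<and>
    V_B s_alpha = (if int p dvd lam1 + 1 then u_alpha else u) \<and>
    V_B s_beta = (if int p dvd lam2 + 1 then u_beta else u) \<and>
    V_B (s_alpha ** s_beta ** s_alpha) = support_variety p SL3 SL3 (lam1, lam2) \<inter> u"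
proof -
  note p = assms(1)
  have p2: "p \<ge> 2" using assms(2) by simp
  have dom: "lam1 \<ge> 0" "lam2 \<ge> 0" using assms(3) by (auto simp: dominant_def)
  have u: "u = low I_B" "u_alpha = low I_alpha" "u_beta = low I_beta"
    by (simp_all only: u_def u_alpha_def u_beta_def lie_uni
        unipotent_radical_Borel unipotent_radical_P_alpha unipotent_radical_P_beta)
  have V: "V_B w = {x \<in> low I_B. \<not> projective p (bundle_sections (schubert w) (lam1, lam2)) (lie_act (schubert w) x)} \<union> {0}" for w
    unfolding V_B_def support_variety_def N1_lie_Borel[OF assms(2)] ..
  have zero: "0 \<in> low I_B" "0 \<in> low I_alpha" "0 \<in> low I_beta"
    by (simp_all add: low_def)
  have dvd: "int p dvd l + 1 \<longleftrightarrow> p dvd Suc (nat l)" if "l \<ge> 0" for l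
  proof -
    have "l + 1 = int (Suc (nat l))" using that by simp
    then show ?thesis by (simp only: int_dvd_int_iff)
  qed
  have "V_B (mat 1) = u"
    unfolding V u schubert_1 using not_projective_Borel[OF p p2 dom] zero by blast
  moreover have "V_B s_alpha = (if int p dvd lam1 + 1 then u_alpha else u)"
    unfolding V u schubert_alpha dvd[OF dom(1)]
    using line_bundle.projective_iff[OF line_bundle_alpha[OF dom] p p2] zero
    by (auto simp: low_iff(2))
  moreover have "V_B s_beta = (if int p dvd lam2 + 1 then u_beta else u)"
    unfolding V u schubert_beta dvd[OF dom(2)]
    using line_bundle.projective_iff[OF line_bundle_beta[OF dom] p p2] zero
    by (auto simp: low_iff(3))
  \<comment> \<open>the two sides concern the same module, and \<open>u\<close> lies in both restricted nullcones\<close>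
  moreover have "V_B (s_alpha ** s_beta ** s_alpha) = support_variety p SL3 SL3 (lam1, lam2) \<inter> u"
    unfolding V u schubert_longest support_variety_def using N1_lie_SL3[OF assms(2)] zero by blast
  ultimately show ?thesis by blast
qed

end
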